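(* Let $(\mathcal{E},\mathcal{T},\mu)$ be a measure space with $\mu$ a non-zero $\sigma$-finite measure, and let $H:\mathcal{E}\to\mathbb{R}_+$ be a $\mathcal{T}$-measurable function. Let $H_{\min}$ be the essential infimum of $H$ with respect to $\mu$ and $\mathcal{E}_{\min}:=H^{-1}(H_{\min})$. Assume: (T1) $\mu(\mathcal{E})=+\infty$; (T2) for every $E\in\mathbb{R}_+$ the quantity $N(E):=\mu(H^{-1}([0,E]))$ is finite, and $\log N(E)=o(E)$ as $E\to+\infty$. For $\beta>0$ put $Z(\beta):=\int_{\mathcal{E}}e^{-\beta H}\,d\mu$ and $\Psi(\beta):=\log Z(\beta)$. For each integer $n\geq 1$ let $H_n:\mathcal{E}^n\to\mathbb{R}_+$, $H_n(x_1,\dots,x_n):=H(x_1)+\dots+H(x_n)$, and for $E\in\mathbb{R}$ let $A_n(E):=\mu^{\otimes n}(\{x\in\mathcal{E}^n\mid H_n(x)\leq nE\})$. Then: 1) For every $E\in(H_{\min},+\infty)$ and every integer $n\geq1$, $A_n(E)\in\mathbb{R}_+^*$, and the limit $S(E):=\lim_{n\to+\infty}\frac1n\log A_n(E)$ exists in $\mathbb{R}$ and equals $\sup_{n\geq1}\frac1n\log A_n(E)$. The function $S:(H_{\min},+\infty)\to\mathbb{R}$ is real analytic, with $S'>0$ and $S''<0$; it satisfies $\lim_{E\to H_{\min}^+}S(E)=\log\mu(\mathcal{E}_{\min})$ (with $\log 0=-\infty$) and $\lim_{E\to+\infty}S(E)=+\infty$; and $S'$ is a real analytic decreasing diffeomorphism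 $(H_{\min},+\infty)\to\mathbb{R}_+^*$. 2) The function $\Psi:\mathbb{R}_+^*\to\mathbb{R}$ is real analytic, with $\Psi'<0$ and $\Psi''>0$. The function $U:=-\Psi'$ is a real analytic decreasing diffeomorphism $\mathbb{R}_+^*\to(H_{\min},+\infty)$, and for every $\beta>0$, $$U(\beta)=\frac{\int_{\mathcal{E}}H\,e^{-\beta H}\,d\mu}{\int_{\mathcal{E}}e^{-\beta H}\,d\mu}.$$ 3) For every $E\in(H_{\min},+\infty)$, $S(E)=\inf_{\beta>0}(\Psi(\beta)+\beta E)$, and for every $\beta>0$, $\Psi(\beta)=\sup_{E\in(H_{\min},+\infty)}(S(E)-\beta E)$. The diffeomorphisms $S'$ and $U$ are inverse to each other. For every $E\in(H_{\min},+\infty)$ and $\beta>0$ one has $S(E)\leq\Psi(\beta)+\beta E$, with equality if and only if $\beta=S'(E)$, equivalently $E=U(\beta)$.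
   Context: $\mu^{\otimes n}$ denotes the product measure on $\mathcal{E}^n$ with the product $\sigma$-algebra $\mathcal{T}^{\otimes n}$. $\mathbb{R}_+^*=(0,+\infty)$. *)

theory Defs
  imports "HOL-Probability.Probability"
begin

text \<open>Intended for open \<open>A\<close>: the power series represents \<open>f\<close> on a full neighbourhood of each point
  of \<open>A\<close>.\<close>

definition real_analytic_on :: "(real \<Rightarrow> real) \<Rightarrow> real set \<Rightarrow> bool"
    (infixl \<open>(real'_analytic'_on)\<close> 50) where
  "f real_analytic_on A \<longleftrightarrow>
     (\<forall>x\<in>A. \<exists>r>0. \<exists>a :: nat \<Rightarrow> real. \<forall>y. \<bar>y - x\<bar> < r \<longrightarrow> (\<lambda>k. a k * (y - x) ^ k) sums f y)"

definition real_analytic_diffeo :: "(real \<Rightarrow> real) \<Rightarrow> real set \<Rightarrow> real set \<Rightarrow> bool" where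
  "real_analytic_diffeo f A B \<longleftrightarrow>
     bij_betw f A B \<and> f real_analytic_on A \<and> inv_into A f real_analytic_on B"

definition ext_log :: "ennreal \<Rightarrow> ereal" where
  "ext_log x = (if x = 0 then -\<infinity> else if x = \<infinity> then \<infinity> else ereal (ln (enn2real x)))"

text \<open>The set is non-empty and bounded above whenever \<open>f\<close> is measurable and non-negative and the
  measure is non-zero, so the real supremum is then the usual essential infimum.\<close>

definition essinf :: "'a measure \<Rightarrow> ('a \<Rightarrow> real) \<Rightarrow> real" where
  "essinf M f = Sup {c. AE x in M. c \<le> f x}"

lemma essinf_well_defined:
  fixes f :: "'a \<Rightarrow> real"
  assumes f[measurable]: "f \<in> borel_measurable M"
    and nonneg: "\<And>x. x \<in> space M \<Longrightarrow> 0 \<le> f x"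
    and nz: "emeasure M (space M) \<noteq> 0"
  shows "0 \<in> {c. AE x in M. c \<le> f x}" and "bdd_above {c. AE x in M. c \<le> f x}"
proof -
  show "0 \<in> {c. AE x in M. c \<le> f x}"
    using nonneg by (auto intro: AE_I2)
  show "bdd_above {c. AE x in M. c \<le> f x}"
  proof (rule ccontr)
    assume unb: "\<not> bdd_above {c. AE x in M. c \<le> f x}"
    have "AE x in M. real n \<le> f x" for n
    proof -
      obtain c where c: "AE x in M. c \<le> f x" "real n < c"
        using unb by (auto simp: bdd_above_def not_le)
      from c(1) show ?thesis by eventually_elim (use c(2) in linarith)
    qed
    then have "AE x in M. \<forall>n. real n \<le> f x"
      by (simp add: AE_all_countable)
    then have "AE x in M. False"
      by eventually_elim (meson not_le reals_Archimedean2)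
    then have "emeasure M (space M) = 0"
      by (simp add: AE_iff_measurable[OF sets.top])
    with nz show False by contradiction
  qed
qed

definition min_level :: "'a measure \<Rightarrow> ('a \<Rightarrow> real) \<Rightarrow> 'a set" where
  "min_level M H = H -` {essinf M H} \<inter> space M"

definition count_N :: "'a measure \<Rightarrow> ('a \<Rightarrow> real) \<Rightarrow> real \<Rightarrow> ennreal" where
  "count_N M H E = emeasure M (H -` {0..E} \<inter> space M)"

definition partition_Z :: "'a measure \<Rightarrow> ('a \<Rightarrow> real) \<Rightarrow> real \<Rightarrow> real" where
  "partition_Z M H \<beta> = (\<integral>x. exp (- \<beta> * H x) \<partial>M)"

definition Psi :: "'a measure \<Rightarrow> ('a \<Rightarrow> real) \<Rightarrow> real \<Rightarrow> real" where
  "Psi M H \<beta> = ln (partition_Z M H \<beta>)"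

definition energy_U :: "'a measure \<Rightarrow> ('a \<Rightarrow> real) \<Rightarrow> real \<Rightarrow> real" where
  "energy_U M H \<beta> = - deriv (Psi M H) \<beta>"

definition H_sum :: "('a \<Rightarrow> real) \<Rightarrow> nat \<Rightarrow> (nat \<Rightarrow> 'a) \<Rightarrow> real" where
  "H_sum H n x = (\<Sum>i\<in>{1..n}. H (x i))"

definition volume_A :: "'a measure \<Rightarrow> ('a \<Rightarrow> real) \<Rightarrow> nat \<Rightarrow> real \<Rightarrow> ennreal" where
  "volume_A M H n E =
     emeasure (\<Pi>\<^sub>M i\<in>{1..n}. M) {x \<in> space (\<Pi>\<^sub>M i\<in>{1..n}. M). H_sum H n x \<le> real n * E}"

definition log_volume :: "'a measure \<Rightarrow> ('a \<Rightarrow> real) \<Rightarrow> nat \<Rightarrow> real \<Rightarrow> real" where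
  "log_volume M H n E = ln (enn2real (volume_A M H n E)) / real n"

definition entropy_S :: "'a measure \<Rightarrow> ('a \<Rightarrow> real) \<Rightarrow> real \<Rightarrow> real" where
  "entropy_S M H E = lim (\<lambda>n. log_volume M H n E)"

end

theory Submission
  imports Defs "HOL-Complex_Analysis.Complex_Analysis"
begin

text \<open>
  Condition (T2) makes all moments of \<open>H\<close> under the weight \<open>e\<^sup>-\<^sup>\<beta>\<^sup>H\<close> finite, so expanding the
  exponential under the integral shows that \<open>Z\<close> is real analytic; \<open>-U'\<close> is the variance of \<open>H\<close> under
  the Gibbs measure, which is positive because (T1) and (T2) prevent \<open>H\<close> from being almost everywhere
  constant.  Chernoff's inequality gives \<open>log A\<^sub>n(E) / n \<le> \<Psi>(\<beta>) + \<beta>E\<close> for all \<open>n\<close> and \<open>\<beta>\<close>.  Conversely,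
  Chebyshev's inequality for the Gibbs weight at a \<open>\<beta>'\<close> slightly larger than the solution \<open>\<beta>\<close> of
  \<open>U(\<beta>) = E\<close> gives a lower bound that tends to \<open>\<Psi>(\<beta>) + \<beta>E\<close> as \<open>\<beta>' \<rightarrow> \<beta>\<close>.  Hence \<open>S\<close> is the Legendre
  transform of \<open>\<Psi>\<close>, it is the supremum of the sequence without any appeal to superadditivity, and
  \<open>S'\<close> is the inverse of \<open>U\<close>.  Real analyticity of compositions and inverses is obtained from local
  holomorphic extensions.
\<close>

subsection \<open>Real analytic functions\<close>

text \<open>Composition and local inversion are easiest for holomorphic functions, so analyticity is
  handled through complex extensions. The radius is explicit so that several extensions can be cut
  down to a common ball.\<close>

definition holomorphic_ext_at :: "(real \<Rightarrow> real) \<Rightarrow> real \<Rightarrow> (complex \<Rightarrow> complex) \<Rightarrow> real \<Rightarrow> bool" where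
  "holomorphic_ext_at f x F r \<longleftrightarrow> 0 < r \<and> F holomorphic_on ball (of_real x) r \<and>
     (\<forall>y. dist x y < r \<longrightarrow> F (of_real y) = of_real (f y))"

lemma holomorphic_ext_at_smaller:
  assumes "holomorphic_ext_at f x F r" "0 < r'" "r' \<le> r"
  shows "holomorphic_ext_at f x F r'"
  using assms unfolding holomorphic_ext_at_def
  by (meson holomorphic_on_subset less_le_trans subset_ball)

text \<open>The complex series with the same real coefficients converges at \<open>w\<close> by
  Abel's lemma: choose \<open>\<rho>\<close> strictly between the distance from \<open>w\<close> to
  the centre and \<open>r\<close>; then the real point \<open>x + \<rho>\<close> is a point of
  convergence.\<close>

lemma power_series_imp_holomorphic_ext:
  fixes a :: "nat \<Rightarrow> real"
  assumes r: "0 < r" and s: "\<And>y. dist x y < r \<Longrightarrow> (\<lambda>k. a k * (y - x) ^ k) sums f y"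
  shows "\<exists>F. holomorphic_ext_at f x F r"
proof -
  define F where "F w = (\<Sum>k. of_real (a k) * (w - of_real x) ^ k)" for w :: complex
  have sums: "(\<lambda>k. of_real (a k) * (w - of_real x) ^ k) sums F w"
    if w: "w \<in> ball (of_real x) r" for w
  proof -
    have nw: "norm (w - of_real x) < r"
      using w by (simp add: dist_norm norm_minus_commute)
    define \<rho> where "\<rho> = (norm (w - of_real x) + r) / 2"
    have \<rho>: "norm (w - of_real x) < \<rho>" "\<rho> < r" "0 < \<rho>"
      using nw r by (auto simp: \<rho>_def add_nonneg_pos)
    have "summable (\<lambda>k. a k * \<rho> ^ k)"
      using s[of "x + \<rho>"] \<rho> by (auto simp: sums_iff dist_real_def)
    then have "summable (\<lambda>k. complex_of_real (a k * \<rho> ^ k))"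
      by (rule summable_of_real)
    then have "summable (\<lambda>k. complex_of_real (a k) * of_real \<rho> ^ k)"
      by simp
    then have "summable (\<lambda>k. complex_of_real (a k) * (w - of_real x) ^ k)"
      by (rule powser_inside) (use \<rho> in simp)
    then show ?thesis
      by (simp add: F_def summable_sums)
  qed
  have "F (of_real y) = of_real (f y)" if "dist x y < r" for y
  proof -
    have "(\<lambda>k. complex_of_real (a k * (y - x) ^ k)) sums of_real (f y)"
      using s[OF that] by (rule sums_of_real)
    then show ?thesis
      by (simp add: F_def sums_iff)
  qed
  then show ?thesis
    unfolding holomorphic_ext_at_def using r power_series_holomorphic[OF sums] by blast
qed

text \<open>In the Taylor expansion of \<open>F\<close> at a real centre the powers of
  \<open>y - x\<close> are real, so taking real parts termwise leaves a real power series for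
  \<open>f\<close>.\<close>

lemma holomorphic_ext_imp_power_series:
  assumes "holomorphic_ext_at f x F r" "dist x y < r"
  shows "(\<lambda>k. Re ((deriv ^^ k) F (of_real x) / fact k) * (y - x) ^ k) sums f y"
proof -
  have "(\<lambda>k. (deriv ^^ k) F (of_real x) / fact k * (of_real y - of_real x) ^ k) sums F (of_real y)"
    using assms by (intro holomorphic_power_series[where r = r]) (auto simp: holomorphic_ext_at_def)
  then have "(\<lambda>k. Re ((deriv ^^ k) F (of_real x) / fact k * (of_real y - of_real x) ^ k))
      sums Re (F (of_real y))"
    by (rule sums_Re)
  moreover have "Re (c * (of_real y - of_real x) ^ k) = Re c * (y - x) ^ k" for c k
  proof -
    have "(of_real y - of_real x) ^ k = complex_of_real ((y - x) ^ k)" by simp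
    then show ?thesis by (simp del: of_real_power of_real_diff)
  qed
  moreover have "Re (F (of_real y)) = f y"
    using assms by (simp add: holomorphic_ext_at_def)
  ultimately show ?thesis
    by (simp only:)
qed

lemma real_analytic_on_iff_holomorphic_ext:
  "f real_analytic_on A \<longleftrightarrow> (\<forall>x\<in>A. \<exists>F r. holomorphic_ext_at f x F r)"
proof -
  have d: "\<bar>y - x\<bar> = dist x y" for x y :: real
    by (simp add: dist_real_def abs_minus_commute)
  show ?thesis
  proof
    assume f: "f real_analytic_on A"
    show "\<forall>x\<in>A. \<exists>F r. holomorphic_ext_at f x F r"
    proof
      fix x assume "x \<in> A"
      then obtain r a where "r > 0" "\<And>y. dist x y < r \<Longrightarrow> (\<lambda>k. a k * (y - x) ^ k) sums f y"
        using f unfolding real_analytic_on_def d by blast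
      then show "\<exists>F r. holomorphic_ext_at f x F r"
        using power_series_imp_holomorphic_ext by blast
    qed
  next
    assume ext: "\<forall>x\<in>A. \<exists>F r. holomorphic_ext_at f x F r"
    show "f real_analytic_on A"
      unfolding real_analytic_on_def d
    proof
      fix x assume "x \<in> A"
      then obtain F r where F: "holomorphic_ext_at f x F r" using ext by blast
      then have "r > 0" by (simp add: holomorphic_ext_at_def)
      then show "\<exists>r>0. \<exists>a. \<forall>y. dist x y < r \<longrightarrow> (\<lambda>k. a k * (y - x) ^ k) sums f y"
        using holomorphic_ext_imp_power_series[OF F]
        by (intro exI[of _ r] conjI exI[of _ "\<lambda>k. Re ((deriv ^^ k) F (of_real x) / fact k)"]) auto
    qed
  qed
qed

text \<open>A power series must represent the function on a full neighbourhood, so the radius is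
  shrunk to stay inside \<open>A\<close>; this is where openness enters.\<close>

lemma real_analytic_on_cong:
  assumes "f real_analytic_on A" "open A" "\<And>x. x \<in> A \<Longrightarrow> f x = g x"
  shows "g real_analytic_on A"
  unfolding real_analytic_on_def
proof
  fix x assume x: "x \<in> A"
  obtain r a where r: "r > 0" "\<And>y. \<bar>y - x\<bar> < r \<Longrightarrow> (\<lambda>k. a k * (y - x) ^ k :: real) sums f y"
    using assms(1) x unfolding real_analytic_on_def by blast
  obtain e where e: "e > 0" "\<And>y. \<bar>y - x\<bar> < e \<Longrightarrow> y \<in> A"
    using \<open>open A\<close> x by (auto simp: open_dist dist_real_def)
  show "\<exists>r>0. \<exists>a. \<forall>y. \<bar>y - x\<bar> < r \<longrightarrow> (\<lambda>k. a k * (y - x) ^ k) sums g y"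
  proof (intro exI[of _ "min r e"] exI[of _ a] conjI allI impI)
    fix y assume "\<bar>y - x\<bar> < min r e"
    then show "(\<lambda>k. a k * (y - x) ^ k) sums g y"
      using r(2)[of y] e(2)[of y] assms(3)[of y] by simp
  qed (use r e in simp)
qed

text \<open>Along the real axis the imaginary part of \<open>F\<close> is constantly 0, hence so is
  its derivative. This transfers a non-zero derivative of \<open>f\<close> to
  \<open>F\<close>.\<close>

lemma holomorphic_ext_at_has_derivative:
  assumes ext: "holomorphic_ext_at f x F r"
  shows "\<exists>D. (f has_field_derivative D) (at x) \<and> deriv F (of_real x) = of_real D"
proof -
  have r: "0 < r" and hol: "F holomorphic_on ball (of_real x) r"
    and eq: "\<And>y. dist x y < r \<Longrightarrow> F (of_real y) = of_real (f y)"
    using ext by (auto simp: holomorphic_ext_at_def)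
  have "(F has_field_derivative deriv F (of_real x)) (at (of_real x))"
    using hol r by (intro holomorphic_derivI[of F "ball (of_real x) r"]) auto
  then have vd: "((\<lambda>y. F (of_real y)) has_vector_derivative deriv F (of_real x)) (at x)"
    by (rule has_vector_derivative_real_field)
  have ev: "\<forall>\<^sub>F y in nhds x. F (of_real y) = of_real (f y)"
    unfolding eventually_nhds_metric using r eq by (auto simp: dist_commute)
  have Re: "(f has_field_derivative Re (deriv F (of_real x))) (at x)"
    using has_field_derivative_Re[OF vd]
    by (rule DERIV_cong_ev[THEN iffD1, rotated -1]) (use ev in \<open>auto elim: eventually_mono\<close>)
  have Im: "((\<lambda>_. 0) has_field_derivative Im (deriv F (of_real x))) (at x)"
    using has_field_derivative_Im[OF vd]
    by (rule DERIV_cong_ev[THEN iffD1, rotated -1]) (use ev in \<open>auto elim: eventually_mono\<close>)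
  have "Im (deriv F (of_real x)) = 0"
    using DERIV_unique[OF Im DERIV_const] by simp
  then have "deriv F (of_real x) = of_real (Re (deriv F (of_real x)))"
    by (simp add: complex_eq_iff)
  then show ?thesis
    using Re by blast
qed

text \<open>By continuity of \<open>F\<close> the radius can be shrunk until \<open>F\<close> maps
  the ball into the domain of the extension of \<open>g\<close>; then the extensions
  compose.\<close>

lemma real_analytic_on_compose:
  assumes f: "f real_analytic_on A" and g: "g real_analytic_on B" and AB: "f ` A \<subseteq> B"
  shows "(\<lambda>x. g (f x)) real_analytic_on A"
  unfolding real_analytic_on_iff_holomorphic_ext
proof
  fix x assume x: "x \<in> A"
  obtain F r where F: "holomorphic_ext_at f x F r"
    using f x unfolding real_analytic_on_iff_holomorphic_ext by blast
  obtain G s where G: "holomorphic_ext_at g (f x) G s"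
    using g x AB unfolding real_analytic_on_iff_holomorphic_ext by blast
  have r: "0 < r" "F holomorphic_on ball (of_real x) r"
    and Feq: "\<And>y. dist x y < r \<Longrightarrow> F (of_real y) = of_real (f y)"
    using F by (auto simp: holomorphic_ext_at_def)
  have s: "0 < s" "G holomorphic_on ball (of_real (f x)) s"
    and Geq: "\<And>y. dist (f x) y < s \<Longrightarrow> G (of_real y) = of_real (g y)"
    using G by (auto simp: holomorphic_ext_at_def)
  have "continuous (at (of_real x)) F"
    using r holomorphic_on_imp_continuous_on continuous_on_eq_continuous_at
    by (metis centre_in_ball open_ball)
  then obtain d where d: "d > 0" "\<And>w. dist w (of_real x) < d \<Longrightarrow> dist (F w) (F (of_real x)) < s"
    using s(1) unfolding continuous_at_eps_delta by blast
  define t where "t = min r d"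
  have Fx: "F (of_real x) = of_real (f x)" using Feq r by simp
  have sub: "F ` ball (of_real x) t \<subseteq> ball (of_real (f x)) s"
    using d Fx by (auto simp: t_def dist_commute)
  have "(G \<circ> F) holomorphic_on ball (of_real x) t"
    using r s sub holomorphic_on_subset[of F _ "ball (of_real x) t"]
    by (intro holomorphic_on_compose_gen[of F _ G "ball (of_real (f x)) s"]) (auto simp: t_def)
  moreover have "(G \<circ> F) (of_real y) = of_real (g (f y))" if y: "dist x y < t" for y
  proof -
    have "F (of_real y) \<in> ball (of_real (f x)) s"
      using y sub by (intro subsetD[OF sub] imageI) simp
    then have "dist (f x) (f y) < s"
      using Feq y by (simp add: t_def)
    then show ?thesis
      using Feq[of y] Geq[of "f y"] y by (simp add: t_def)
  qed
  ultimately have "holomorphic_ext_at (\<lambda>x. g (f x)) x (G \<circ> F) t"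
    using r d by (auto simp: holomorphic_ext_at_def t_def)
  then show "\<exists>F r. holomorphic_ext_at (\<lambda>x. g (f x)) x F r"
    by blast
qed

text \<open>The operation enters in a complex version \<open>opc\<close> and a real version
  \<open>opr\<close>, so that one argument serves sums and products.\<close>

lemma real_analytic_on_binop:
  assumes f: "f real_analytic_on A" and g: "g real_analytic_on A"
    and hol: "\<And>F G z r. F holomorphic_on ball z r \<Longrightarrow> G holomorphic_on ball z r \<Longrightarrow>
               (\<lambda>w. opc (F w) (G w)) holomorphic_on ball z r"
    and eq: "\<And>a b. opc (of_real a) (of_real b) = complex_of_real (opr a b)"
  shows "(\<lambda>x. opr (f x) (g x)) real_analytic_on A"
  unfolding real_analytic_on_iff_holomorphic_ext
proof
  fix x assume x: "x \<in> A"
  obtain F r G s where F: "holomorphic_ext_at f x F r" and G: "holomorphic_ext_at g x G s"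
    using f g x unfolding real_analytic_on_iff_holomorphic_ext by blast
  define t where "t = min r s"
  have t: "t > 0" "t \<le> r" "t \<le> s"
    using F G by (auto simp: holomorphic_ext_at_def t_def)
  have "holomorphic_ext_at (\<lambda>x. opr (f x) (g x)) x (\<lambda>w. opc (F w) (G w)) t"
    using holomorphic_ext_at_smaller[OF F t(1,2)] holomorphic_ext_at_smaller[OF G t(1,3)] hol
    by (simp add: holomorphic_ext_at_def eq)
  then show "\<exists>F r. holomorphic_ext_at (\<lambda>x. opr (f x) (g x)) x F r"
    by blast
qed

lemma real_analytic_on_add:
  assumes "f real_analytic_on A" "g real_analytic_on A"
  shows "(\<lambda>x. f x + g x) real_analytic_on A"
  by (rule real_analytic_on_binop[OF assms, of "(+)"]) (auto intro: holomorphic_on_add holomorphic_on_mult)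

lemma real_analytic_on_mult:
  assumes "f real_analytic_on A" "g real_analytic_on A"
  shows "(\<lambda>x. f x * g x) real_analytic_on A"
  by (rule real_analytic_on_binop[OF assms, of "(*)"]) (auto intro: holomorphic_on_add holomorphic_on_mult)

lemma real_analytic_on_ident: "(\<lambda>x. x) real_analytic_on A"
  unfolding real_analytic_on_iff_holomorphic_ext holomorphic_ext_at_def
  by (auto intro!: exI[of _ "\<lambda>w. w"] exI[of _ 1])

lemma real_analytic_on_inverse: "(inverse :: real \<Rightarrow> real) real_analytic_on {0<..}"
  unfolding real_analytic_on_iff_holomorphic_ext
proof
  fix x :: real assume x: "x \<in> {0<..}"
  \<comment> \<open>The ball of radius \<open>x\<close> around \<open>x\<close> omits 0, the only
    pole.\<close>
  have "holomorphic_ext_at inverse x inverse x"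
    using x by (auto simp: holomorphic_ext_at_def intro!: holomorphic_intros)
  then show "\<exists>F r. holomorphic_ext_at inverse x F r" by blast
qed

lemma real_analytic_on_ln: "(ln :: real \<Rightarrow> real) real_analytic_on {0<..}"
  unfolding real_analytic_on_iff_holomorphic_ext
proof
  fix x :: real assume x: "x \<in> {0<..}"
  \<comment> \<open>The ball of radius \<open>x\<close> around \<open>x\<close> lies in the right
    half-plane, away from the branch cut of \<open>Ln\<close>.\<close>
  have "0 < Re w" if "w \<in> ball (of_real x) x" for w
  proof -
    have "\<bar>x - Re w\<bar> < x"
      using that abs_Re_le_cmod[of "of_real x - w"] by (simp add: dist_norm)
    then show ?thesis by linarith
  qed
  then have "Ln holomorphic_on ball (of_real x) x"
    by (intro holomorphic_intros) (auto simp: complex_nonpos_Reals_iff not_le)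
  then have "holomorphic_ext_at ln x Ln x"
    using x by (auto simp: holomorphic_ext_at_def dist_real_def intro!: Ln_of_real)
  then show "\<exists>F r. holomorphic_ext_at ln x F r" by blast
qed

text \<open>Since the derivative of \<open>F\<close> at \<open>x\<close> is non-zero,
  \<open>F\<close> has a holomorphic inverse \<open>G\<close> on the image of a small ball.
  Continuity of \<open>g\<close> keeps \<open>g u\<close> in that ball for \<open>u\<close> near
  \<open>t\<close>, so \<open>G\<close> extends \<open>g\<close> and not some other branch of the
  inverse.\<close>

lemma real_analytic_on_inverse_function:
  fixes f g :: "real \<Rightarrow> real"
  assumes f: "f real_analytic_on A" and B: "open B"
    and gB: "\<And>t. t \<in> B \<Longrightarrow> g t \<in> A" and fg: "\<And>t. t \<in> B \<Longrightarrow> f (g t) = t"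
    and cont: "\<And>t. t \<in> B \<Longrightarrow> isCont g t"
    and D: "\<And>x. x \<in> A \<Longrightarrow> (f has_field_derivative f' x) (at x)" "\<And>x. x \<in> A \<Longrightarrow> f' x \<noteq> 0"
  shows "g real_analytic_on B"
  unfolding real_analytic_on_iff_holomorphic_ext
proof
  fix t assume t: "t \<in> B"
  define x where "x = g t"
  have x: "x \<in> A" "f x = t" using t gB fg by (auto simp: x_def)
  obtain F r where F: "holomorphic_ext_at f x F r"
    using f x unfolding real_analytic_on_iff_holomorphic_ext by blast
  have r: "0 < r" "F holomorphic_on ball (of_real x) r"
    and Feq: "\<And>y. dist x y < r \<Longrightarrow> F (of_real y) = of_real (f y)"
    using F by (auto simp: holomorphic_ext_at_def)
  have "deriv F (of_real x) \<noteq> 0"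
  proof -
    obtain d where d: "(f has_field_derivative d) (at x)" "deriv F (of_real x) = of_real d"
      using holomorphic_ext_at_has_derivative[OF F] by blast
    then have "d = f' x"
      using D(1)[OF x(1)] DERIV_unique by blast
    then show ?thesis
      using d(2) D(2)[OF x(1)] by simp
  qed
  then obtain s where s: "s > 0" "ball (complex_of_real x) s \<subseteq> ball (complex_of_real x) r"
      "open (F ` ball (of_real x) s)" "inj_on F (ball (of_real x) s)"
    using has_complex_derivative_locally_invertible[OF r(2), of "of_real x"] r(1)
    by (metis centre_in_ball open_ball)
  have hols: "F holomorphic_on ball (of_real x) s"
    using r(2) s(2) holomorphic_on_subset by blast
  obtain G where G: "G holomorphic_on F ` ball (of_real x) s"
      "\<And>z. z \<in> ball (of_real x) s \<Longrightarrow> G (F z) = z"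
    using holomorphic_has_inverse[OF hols open_ball s(4)] by blast
  have "of_real t \<in> F ` ball (of_real x) s"
    using Feq[of x] x s(1) r(1) by (auto intro!: image_eqI[of _ _ "of_real x"])
  then obtain e where e: "e > 0" "ball (complex_of_real t) e \<subseteq> F ` ball (of_real x) s"
    using s(3) open_contains_ball by blast
  obtain d where d: "d > 0" "\<And>u. dist t u < d \<Longrightarrow> dist x (g u) < s"
    using cont[OF t] s(1) unfolding continuous_at_eps_delta x_def by (metis dist_commute)
  obtain c where c: "c > 0" "\<And>u. dist t u < c \<Longrightarrow> u \<in> B"
    using B t by (auto simp: open_dist dist_commute)
  define q where "q = min e (min d c)"
  have "G (of_real u) = of_real (g u)" if u: "dist t u < q" for u
  proof -
    have gu: "of_real (g u) \<in> ball (complex_of_real x) s"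
      using d(2)[of u] u by (simp add: q_def)
    then have "of_real (g u) \<in> ball (complex_of_real x) r" using s(2) by blast
    then have "F (of_real (g u)) = of_real u"
      using Feq[of "g u"] fg[of u] c(2)[of u] u by (simp add: q_def)
    then show ?thesis
      using G(2)[OF gu] by simp
  qed
  moreover have "G holomorphic_on ball (of_real t) q"
    using e(2) by (intro holomorphic_on_subset[OF G(1)]) (auto simp: q_def)
  ultimately have "holomorphic_ext_at g t G q"
    using e d c by (simp add: holomorphic_ext_at_def q_def)
  then show "\<exists>F r. holomorphic_ext_at g t F r" by blast
qed

text \<open>Lets the derivatives of the moments be read off from their expansions, in place of a
  separate differentiation under the integral.\<close>

lemma DERIV_power_series_at_centre:
  fixes a :: "nat \<Rightarrow> real"
  assumes r: "0 < r" and s: "\<And>y. \<bar>y - x\<bar> < r \<Longrightarrow> (\<lambda>k. a k * (y - x) ^ k) sums f y"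
  shows "(f has_field_derivative a 1) (at x)"
proof -
  have s': "(\<lambda>k. a k * z ^ k) sums f (x + z)" if "\<bar>z\<bar> < r" for z
    using s[of "x + z"] that by simp
  have "((\<lambda>z. \<Sum>k. a k * z ^ k) has_field_derivative (\<Sum>k. diffs a k * 0 ^ k)) (at 0)"
    using r s' by (intro termdiffs_strong'[where K = r]) (auto simp: sums_iff)
  moreover have "(\<Sum>k. diffs a k * 0 ^ k) = a 1"
    by (simp add: diffs_def)
  moreover have "\<forall>\<^sub>F z in nhds 0. (\<Sum>k. a k * z ^ k) = f (x + z)"
    unfolding eventually_nhds_metric using r s' by (auto simp: sums_iff dist_real_def)
  ultimately have "((\<lambda>z. f (x + z)) has_field_derivative a 1) (at 0)"
    using DERIV_cong_ev[OF refl _ refl] by force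
  then show ?thesis
    using DERIV_shift[of f "a 1" 0 x] by (simp add: add.commute)
qed

text \<open>One term of the exponential series is at most the whole sum, all terms being
  non-negative.\<close>

lemma power_le_fact_mult_exp:
  fixes t :: real
  assumes "0 \<le> t"
  shows "t ^ k \<le> fact k * exp t"
proof -
  have "(\<Sum>i\<in>{k}. t ^ i /\<^sub>R fact i) \<le> (\<Sum>i. t ^ i /\<^sub>R fact i)"
    using assms by (intro sum_le_suminf summable_exp_generic) auto
  then show ?thesis
    by (simp add: exp_def field_simps)
qed

lemma eventually_nhds_greaterThan: "(a::real) < x \<Longrightarrow> \<forall>\<^sub>F y in nhds x. a < y"
  by (rule eventually_nhds_in_open[of "{a<..}", simplified])

subsection \<open>Moments of the Boltzmann weight\<close>

locale gibbs_system = sigma_finite_measure M for M :: "'a measure" +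
  fixes H :: "'a \<Rightarrow> real"
  assumes H_measurable [measurable]: "H \<in> borel_measurable M"
    and H_nonneg: "\<And>x. x \<in> space M \<Longrightarrow> 0 \<le> H x"
    and infinite_volume: "emeasure M (space M) = \<infinity>"
    and count_N_finite: "\<And>E. 0 \<le> E \<Longrightarrow> count_N M H E < \<infinity>"
    and count_N_growth: "(\<lambda>E. ln (enn2real (count_N M H E))) \<in> o[at_top](\<lambda>E. E)"
begin

lemma count_N_eq: "count_N M H E = emeasure M {x \<in> space M. H x \<le> E}"
  unfolding count_N_def using H_nonneg by (intro arg_cong[where f = "emeasure M"]) auto

lemma count_N_finite': "count_N M H E < \<infinity>"
proof -
  have "count_N M H E \<le> count_N M H (max 0 E)"
    unfolding count_N_eq by (intro emeasure_mono) auto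
  then show ?thesis
    using count_N_finite[of "max 0 E"] by (simp add: order.strict_trans1)
qed

lemma ennreal_count_N: "ennreal (enn2real (count_N M H E)) = count_N M H E"
  using count_N_finite'[of E] by (simp add: less_top)

text \<open>The sublevel sets at integer energies exhaust a space of infinite measure, so continuity
  from below makes their measures unbounded.\<close>

lemma count_N_unbounded: "\<exists>E\<ge>0. C < enn2real (count_N M H E)"
proof -
  define A where "A n = {x \<in> space M. H x \<le> real n}" for n
  have inc: "incseq A"
    by (auto simp: A_def incseq_def)
  have "range A \<subseteq> sets M"
    by (auto simp: A_def)
  with inc have "(SUP n. emeasure M (A n)) = emeasure M (\<Union>n. A n)"
    by (intro SUP_emeasure_incseq)
  also have "(\<Union>n. A n) = space M"
    by (auto simp: A_def real_arch_simple)
  finally have "ennreal (max C 0) < (SUP n. emeasure M (A n))"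
    using infinite_volume by (metis ennreal_less_top infinity_ennreal_def)
  then obtain n where "ennreal (max C 0) < emeasure M (A n)"
    by (auto simp: less_SUP_iff)
  then have "ennreal (max C 0) < ennreal (enn2real (count_N M H (real n)))"
    unfolding ennreal_count_N by (simp add: A_def count_N_eq)
  then have "max C 0 < enn2real (count_N M H (real n))"
    by (subst (asm) ennreal_less_iff) auto
  then show ?thesis
    by (intro exI[of _ "real n"]) simp
qed

text \<open>Cutting the space at integer energies bounds the integral by the series of
  \<open>exp (- \<beta> * n) * N (n + 1)\<close>, and subexponential growth of \<open>N\<close>
  makes this series converge.\<close>

lemma integrable_exp_H:
  assumes "0 < \<beta>"
  shows "integrable M (\<lambda>x. exp (- \<beta> * H x))"
proof (rule integrableI_nonneg)
  let ?N = "\<lambda>E. enn2real (count_N M H E)"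
  let ?A = "\<lambda>n::nat. {x \<in> space M. H x \<le> real n + 1}"
  \<comment> \<open>Half of the decay rate \<open>\<beta>\<close> absorbs the growth of
    \<open>N\<close>; the other half leaves a geometric series.\<close>
  have "\<forall>\<^sub>F E in at_top. norm (ln (?N E)) \<le> \<beta> / 2 * norm E"
    using landau_o.smallD[OF count_N_growth, of "\<beta> / 2"] assms by simp
  then obtain E0 where E0: "\<And>E. E \<ge> E0 \<Longrightarrow> norm (ln (?N E)) \<le> \<beta> / 2 * norm E"
    unfolding eventually_at_top_linorder by blast
  \<comment> \<open>The case \<open>?N E = 0\<close> is split off because \<open>ln 0\<close> is a
    default value and cannot be exponentiated back.\<close>
  have N_le: "?N E \<le> exp (\<beta> / 2 * E)" if "E \<ge> E0" "E \<ge> 0" for E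
  proof (cases "?N E = 0")
    case False
    then have "?N E = exp (ln (?N E))"
      by (simp add: order.strict_iff_order)
    also have "\<dots> \<le> exp (\<beta> / 2 * E)"
      using E0[OF that(1)] that(2) by simp
    finally show ?thesis .
  qed simp
  have summ: "summable (\<lambda>n. exp (- \<beta> * real n) * ?N (real n + 1))"
  proof (rule summable_comparison_test_ev)
    show "summable (\<lambda>n. exp (\<beta> / 2) * exp (- \<beta> / 2) ^ n)"
      using assms by (intro summable_mult summable_geometric) simp
    show "\<forall>\<^sub>F n in sequentially. norm (exp (- \<beta> * real n) * ?N (real n + 1))
        \<le> exp (\<beta> / 2) * exp (- \<beta> / 2) ^ n"
      using eventually_ge_at_top[of "nat \<lceil>E0\<rceil>"]
    proof eventually_elim
      case (elim n)
      then have "?N (real n + 1) \<le> exp (\<beta> / 2 * (real n + 1))"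
        by (intro N_le) linarith+
      then have "exp (- \<beta> * real n) * ?N (real n + 1) \<le> exp (- \<beta> * real n) * exp (\<beta> / 2 * (real n + 1))"
        by (intro mult_left_mono) auto
      also have "\<dots> = exp (\<beta> / 2) * exp (- \<beta> / 2) ^ n"
        by (simp add: exp_of_nat_mult[symmetric] exp_add[symmetric] field_simps)
      finally show ?case by simp
    qed
  qed
  have "(\<integral>\<^sup>+ x. ennreal (exp (- \<beta> * H x)) \<partial>M)
      \<le> (\<integral>\<^sup>+ x. (\<Sum>n. ennreal (exp (- \<beta> * real n)) * indicator (?A n) x) \<partial>M)"
  proof (rule nn_integral_mono)
    fix x assume x: "x \<in> space M"
    \<comment> \<open>The single term whose index is the integer part of \<open>H x\<close> already
      dominates the integrand.\<close>
    define n where "n = nat \<lfloor>H x\<rfloor>"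
    have n: "real n \<le> H x" "H x \<le> real n + 1"
      using H_nonneg[OF x] unfolding n_def by linarith+
    have "ennreal (exp (- \<beta> * H x)) \<le> ennreal (exp (- \<beta> * real n)) * indicator (?A n) x"
      using x n assms by (simp add: ennreal_leI)
    also have "\<dots> = (\<Sum>i\<in>{n}. ennreal (exp (- \<beta> * real i)) * indicator (?A i) x)"
      by (subst sum.insert) simp_all
    also have "\<dots> \<le> (\<Sum>n. ennreal (exp (- \<beta> * real n)) * indicator (?A n) x)"
      by (intro sum_le_suminf summableI) auto
    finally show "ennreal (exp (- \<beta> * H x)) \<le> \<dots>" .
  qed
  also have "\<dots> = (\<Sum>n. ennreal (exp (- \<beta> * real n)) * emeasure M (?A n))"
    by (subst nn_integral_suminf) (auto simp: nn_integral_cmult_indicator)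
  also have "\<dots> = (\<Sum>n. ennreal (exp (- \<beta> * real n) * ?N (real n + 1)))"
    by (intro suminf_cong) (simp add: ennreal_mult ennreal_count_N, simp add: count_N_eq)
  also have "\<dots> < \<infinity>"
    using summ by (subst suminf_ennreal2) auto
  finally show "(\<integral>\<^sup>+ x. ennreal (exp (- \<beta> * H x)) \<partial>M) < \<infinity>" .
qed auto

text \<open>Half of the exponential decay absorbs the power of \<open>H\<close>, and the other half
  is integrable.\<close>

lemma integrable_moment:
  assumes "0 < \<beta>"
  shows "integrable M (\<lambda>x. H x ^ k * exp (- \<beta> * H x))"
proof (rule Bochner_Integration.integrable_bound)
  show "integrable M (\<lambda>x. fact k / (\<beta> / 2) ^ k * exp (- (\<beta> / 2) * H x))"
    using assms by (intro integrable_mult_right integrable_exp_H) simp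
  show "AE x in M. norm (H x ^ k * exp (- \<beta> * H x)) \<le> norm (fact k / (\<beta> / 2) ^ k * exp (- (\<beta> / 2) * H x))"
  proof (rule AE_I2)
    fix x assume x: "x \<in> space M"
    have "(\<beta> / 2 * H x) ^ k \<le> fact k * exp (\<beta> / 2 * H x)"
      using assms H_nonneg[OF x] by (intro power_le_fact_mult_exp) simp
    then have "(\<beta> / 2 * H x) ^ k * exp (- \<beta> * H x) \<le> fact k * exp (\<beta> / 2 * H x) * exp (- \<beta> * H x)"
      by (intro mult_right_mono) auto
    also have "\<dots> = fact k * exp (- (\<beta> / 2) * H x)"
      by (simp add: exp_add[symmetric] mult.assoc)
    finally have "H x ^ k * exp (- \<beta> * H x) \<le> fact k / (\<beta> / 2) ^ k * exp (- (\<beta> / 2) * H x)"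
      using assms by (simp add: power_mult_distrib field_simps)
    then show "norm (H x ^ k * exp (- \<beta> * H x)) \<le> norm (fact k / (\<beta> / 2) ^ k * exp (- (\<beta> / 2) * H x))"
      using assms H_nonneg[OF x] by simp
  qed
qed measurable

text \<open>Left unnormalised, so that differentiation only raises the index and changes the sign.
  \<open>moment 0\<close> is the partition function.\<close>

definition moment :: "nat \<Rightarrow> real \<Rightarrow> real" where
  "moment k \<beta> = (\<integral>x. H x ^ k * exp (- \<beta> * H x) \<partial>M)"

text \<open>Expand \<open>exp (- (y - \<beta>) * H x)\<close> and integrate term by term. The
  absolute values sum to \<open>exp (d * H x)\<close> times the original integrand, which is
  integrable because \<open>\<beta> - d\<close> is still positive; hence the radius
  \<open>\<beta>\<close>.\<close>

lemma moment_sums: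
  assumes \<beta>: "0 < \<beta>" and y: "\<bar>y - \<beta>\<bar> < \<beta>"
  shows "(\<lambda>j. (- 1) ^ j * moment (k + j) \<beta> / fact j * (y - \<beta>) ^ j) sums moment k y"
proof -
  define d where "d = \<bar>y - \<beta>\<bar>"
  define f where "f j x = (- (y - \<beta>)) ^ j / fact j * (H x ^ (k + j) * exp (- \<beta> * H x))" for j x
  have int: "integrable M (f j)" for j
    unfolding f_def by (intro integrable_mult_right integrable_moment \<beta>)
  have f_eq: "f j x = H x ^ k * exp (- \<beta> * H x) * ((- (y - \<beta>) * H x) ^ j /\<^sub>R fact j)" for j x
    by (simp add: f_def power_add power_mult_distrib[of _ "H x"] divide_inverse del: mult_minus_left)
  have norm_f: "norm (f j x) = H x ^ k * exp (- \<beta> * H x) * ((d * H x) ^ j /\<^sub>R fact j)"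
    if "x \<in> space M" for j x
    using H_nonneg[OF that] by (simp add: f_eq abs_mult power_abs d_def abs_minus_commute)
  have exp_series: "exp t = (\<Sum>j. t ^ j /\<^sub>R fact j)" for t :: real
    by (simp add: exp_def)
  have exp_eq: "H x ^ k * exp (- \<beta> * H x) * exp (s * H x) = H x ^ k * exp (- (\<beta> - s) * H x)" for s x
    by (simp add: exp_add[symmetric] mult.assoc) (simp add: algebra_simps)
  have summ: "summable (\<lambda>j. \<integral>x. norm (f j x) \<partial>M)"
  proof (rule summableI_nonneg_bounded)
    fix n
    have "(\<Sum>j<n. \<integral>x. norm (f j x) \<partial>M) = (\<integral>x. (\<Sum>j<n. norm (f j x)) \<partial>M)"
      by (rule Bochner_Integration.integral_sum[symmetric]) (use int in auto)
    also have "\<dots> \<le> (\<integral>x. H x ^ k * exp (- (\<beta> - d) * H x) \<partial>M)"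
    proof (rule integral_mono)
      show "integrable M (\<lambda>x. H x ^ k * exp (- (\<beta> - d) * H x))"
        using y by (intro integrable_moment) (simp add: d_def)
      fix x assume x: "x \<in> space M"
      have "(\<Sum>j<n. norm (f j x)) = H x ^ k * exp (- \<beta> * H x) * (\<Sum>j<n. (d * H x) ^ j /\<^sub>R fact j)"
        by (simp only: norm_f[OF x] sum_distrib_left)
      also have "\<dots> \<le> H x ^ k * exp (- \<beta> * H x) * exp (d * H x)"
        unfolding exp_series[of "d * H x"] using H_nonneg[OF x]
        by (intro mult_left_mono sum_le_suminf summable_exp_generic) (auto simp: d_def)
      finally show "(\<Sum>j<n. norm (f j x)) \<le> H x ^ k * exp (- (\<beta> - d) * H x)"
        by (simp only: exp_eq)
    qed (use int in auto)
    finally show "(\<Sum>j<n. \<integral>x. norm (f j x) \<partial>M) \<le> (\<integral>x. H x ^ k * exp (- (\<beta> - d) * H x) \<partial>M)" .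
  qed simp
  have "AE x in M. summable (\<lambda>j. norm (f j x))"
  proof (rule AE_I2)
    fix x assume x: "x \<in> space M"
    show "summable (\<lambda>j. norm (f j x))"
      unfolding norm_f[OF x] by (intro summable_mult summable_exp_generic)
  qed
  then have "(\<lambda>j. integral\<^sup>L M (f j)) sums (\<integral>x. (\<Sum>j. f j x) \<partial>M)"
    using int summ by (intro sums_integral) auto
  moreover have "(\<Sum>j. f j x) = H x ^ k * exp (- y * H x)" for x
  proof -
    have "(\<Sum>j. f j x) = H x ^ k * exp (- \<beta> * H x) * exp (- (y - \<beta>) * H x)"
      unfolding f_eq exp_series[of "- (y - \<beta>) * H x"] by (intro suminf_mult summable_exp_generic)
    also have "\<dots> = H x ^ k * exp (- y * H x)"
      by (subst exp_eq) simp
    finally show ?thesis .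
  qed
  moreover have "integral\<^sup>L M (f j) = (- 1) ^ j * moment (k + j) \<beta> / fact j * (y - \<beta>) ^ j" for j
    unfolding f_def moment_def power_minus[of "y - \<beta>"] by simp
  ultimately show ?thesis
    by (simp add: moment_def)
qed

lemma moment_real_analytic: "moment k real_analytic_on {0<..}"
  unfolding real_analytic_on_def
proof
  fix \<beta> :: real assume "\<beta> \<in> {0<..}"
  then show "\<exists>r>0. \<exists>a. \<forall>y. \<bar>y - \<beta>\<bar> < r \<longrightarrow> (\<lambda>j. a j * (y - \<beta>) ^ j) sums moment k y"
    using moment_sums[of \<beta> _ k]
    by (intro exI[of _ \<beta>] conjI exI[of _ "\<lambda>j. (- 1) ^ j * moment (k + j) \<beta> / fact j"]) auto
qed

lemma DERIV_moment:
  assumes "0 < \<beta>"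
  shows "(moment k has_field_derivative - moment (Suc k) \<beta>) (at \<beta>)"
  using DERIV_power_series_at_centre[OF assms moment_sums[OF assms]] by simp

lemma partition_Z_eq: "partition_Z M H = moment 0"
  by (simp add: fun_eq_iff partition_Z_def moment_def)

text \<open>On the sublevel set at \<open>E\<close> the weight is at least
  \<open>exp (- \<beta> * E)\<close>. This yields positivity of the partition function and the
  growth of \<open>Psi\<close> at both ends.\<close>

lemma partition_Z_lower_bound:
  assumes "0 < \<beta>"
  shows "exp (- \<beta> * E) * enn2real (count_N M H E) \<le> moment 0 \<beta>"
proof -
  let ?A = "{x \<in> space M. H x \<le> E}"
  have "exp (- \<beta> * E) * enn2real (count_N M H E) = (\<integral>x. exp (- \<beta> * E) * indicator ?A x \<partial>M)"
    by (simp add: count_N_eq measure_def)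
  also have "\<dots> \<le> moment 0 \<beta>"
    unfolding moment_def
  proof (rule integral_mono)
    show "integrable M (\<lambda>x. exp (- \<beta> * E) * indicator ?A x)"
      using count_N_finite'[of E] by (intro integrable_mult_right integrable_real_indicator) (auto simp: count_N_eq)
    show "integrable M (\<lambda>x. H x ^ 0 * exp (- \<beta> * H x))"
      by (rule integrable_moment[OF assms])
  qed (use assms in \<open>auto simp: indicator_def\<close>)
  finally show ?thesis .
qed

lemma moment_0_pos:
  assumes "0 < \<beta>"
  shows "0 < moment 0 \<beta>"
proof -
  obtain E where "0 < enn2real (count_N M H E)"
    using count_N_unbounded[of 0] by blast
  then have "0 < exp (- \<beta> * E) * enn2real (count_N M H E)"
    by simp
  also have "\<dots> \<le> moment 0 \<beta>"
    by (rule partition_Z_lower_bound[OF assms])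
  finally show ?thesis .
qed

text \<open>Otherwise one sublevel set, of finite measure, would carry the whole infinite
  measure.\<close>

lemma H_not_AE_const: "\<not> (AE x in M. H x = u)"
proof
  assume "AE x in M. H x = u"
  then have "emeasure M {x \<in> space M. H x \<le> u} = emeasure M (space M)"
    by (intro emeasure_eq_AE) auto
  then show False
    using count_N_finite'[of u] infinite_volume by (simp add: count_N_eq)
qed

lemma moment_variance:
  assumes "0 < \<beta>"
  shows "integrable M (\<lambda>x. (H x - u)\<^sup>2 * exp (- \<beta> * H x))"
    and "(\<integral>x. (H x - u)\<^sup>2 * exp (- \<beta> * H x) \<partial>M)
           = moment 2 \<beta> - 2 * u * moment 1 \<beta> + u\<^sup>2 * moment 0 \<beta>"
proof -
  have eq: "(H x - u)\<^sup>2 * exp (- \<beta> * H x) = H x ^ 2 * exp (- \<beta> * H x)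
      - (2 * u) * (H x ^ 1 * exp (- \<beta> * H x)) + u\<^sup>2 * (H x ^ 0 * exp (- \<beta> * H x))" for x
    by (simp add: power2_eq_square algebra_simps)
  note int = integrable_moment[OF assms]
  show "integrable M (\<lambda>x. (H x - u)\<^sup>2 * exp (- \<beta> * H x))"
    unfolding eq
    by (intro Bochner_Integration.integrable_add Bochner_Integration.integrable_diff integrable_mult_right int)
  show "(\<integral>x. (H x - u)\<^sup>2 * exp (- \<beta> * H x) \<partial>M)
      = moment 2 \<beta> - 2 * u * moment 1 \<beta> + u\<^sup>2 * moment 0 \<beta>"
    unfolding eq moment_def
    using int[of 2] int[of 1] int[of 0]
    by (subst Bochner_Integration.integral_add Bochner_Integration.integral_diff integral_mult_right_zero;
        (intro Bochner_Integration.integrable_diff integrable_mult_right int)?)+ simp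
qed

lemma moment_variance_pos:
  assumes "0 < \<beta>"
  shows "0 < (\<integral>x. (H x - u)\<^sup>2 * exp (- \<beta> * H x) \<partial>M)"
proof -
  have "(\<integral>x. (H x - u)\<^sup>2 * exp (- \<beta> * H x) \<partial>M) \<noteq> 0"
  proof
    assume "(\<integral>x. (H x - u)\<^sup>2 * exp (- \<beta> * H x) \<partial>M) = 0"
    then have "AE x in M. (H x - u)\<^sup>2 * exp (- \<beta> * H x) = 0"
      using integral_nonneg_eq_0_iff_AE[OF moment_variance(1)[OF assms, of u]] by simp
    then have "AE x in M. H x = u" by simp
    then show False using H_not_AE_const by blast
  qed
  moreover have "0 \<le> (\<integral>x. (H x - u)\<^sup>2 * exp (- \<beta> * H x) \<partial>M)"
    by simp
  ultimately show ?thesis by linarith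
qed

text \<open>Strictness comes from the positive second moment of \<open>H\<close> about every
  \<open>u\<close>, that is, from \<open>H\<close> not being almost everywhere constant.\<close>

lemma moment_cauchy_schwarz:
  assumes "0 < \<beta>"
  shows "(moment 1 \<beta>)\<^sup>2 < moment 2 \<beta> * moment 0 \<beta>"
proof -
  \<comment> \<open>The mean minimises the quadratic in \<open>u\<close>; its minimum times
    \<open>moment 0 \<beta>\<close> is the difference to be shown positive.\<close>
  define u where "u = moment 1 \<beta> / moment 0 \<beta>"
  have "0 < moment 2 \<beta> - 2 * u * moment 1 \<beta> + u\<^sup>2 * moment 0 \<beta>"
    using moment_variance_pos[OF assms, of u] moment_variance(2)[OF assms, of u] by simp
  then have "0 < (moment 2 \<beta> - 2 * u * moment 1 \<beta> + u\<^sup>2 * moment 0 \<beta>) * moment 0 \<beta>"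
    using moment_0_pos[OF assms] by simp
  also have "\<dots> = moment 2 \<beta> * moment 0 \<beta> - (moment 1 \<beta>)\<^sup>2"
    using moment_0_pos[OF assms] by (simp add: u_def field_simps power2_eq_square)
  finally show ?thesis by simp
qed

subsection \<open>Mean energy\<close>

lemma Psi_eq: "Psi M H \<beta> = ln (moment 0 \<beta>)"
  by (simp add: Psi_def partition_Z_eq)

lemma DERIV_Psi:
  assumes "0 < \<beta>"
  shows "(Psi M H has_field_derivative - (moment 1 \<beta> / moment 0 \<beta>)) (at \<beta>)"
proof -
  have "((\<lambda>\<beta>. ln (moment 0 \<beta>)) has_field_derivative - (moment 1 \<beta> / moment 0 \<beta>)) (at \<beta>)"
    using moment_0_pos[OF assms] DERIV_moment[OF assms, of 0]
    by (auto intro!: derivative_eq_intros)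
  then show ?thesis
    by (simp add: Psi_eq[abs_def])
qed

lemma energy_U_eq:
  assumes "0 < \<beta>"
  shows "energy_U M H \<beta> = moment 1 \<beta> / moment 0 \<beta>"
  using DERIV_imp_deriv[OF DERIV_Psi[OF assms]] by (simp add: energy_U_def)

lemma DERIV_Psi':
  assumes "0 < \<beta>"
  shows "(Psi M H has_field_derivative - energy_U M H \<beta>) (at \<beta>)"
  using DERIV_Psi[OF assms] by (simp add: energy_U_eq[OF assms])

text \<open>The variance of \<open>H\<close> under the normalised Gibbs measure, written over a
  common denominator.\<close>

definition energy_variance :: "real \<Rightarrow> real" where
  "energy_variance \<beta> = (moment 2 \<beta> * moment 0 \<beta> - (moment 1 \<beta>)\<^sup>2) / (moment 0 \<beta>)\<^sup>2"

lemma energy_variance_pos: "0 < \<beta> \<Longrightarrow> 0 < energy_variance \<beta>"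
  using moment_cauchy_schwarz[of \<beta>] moment_0_pos[of \<beta>]
  unfolding energy_variance_def by (intro divide_pos_pos) auto

lemma DERIV_energy_U:
  assumes "0 < \<beta>"
  shows "(energy_U M H has_field_derivative - energy_variance \<beta>) (at \<beta>)"
proof -
  have "((\<lambda>\<beta>. moment 1 \<beta> / moment 0 \<beta>) has_field_derivative - energy_variance \<beta>) (at \<beta>)"
    using moment_0_pos[OF assms] DERIV_moment[OF assms, of 0] DERIV_moment[OF assms, of 1]
    by (auto intro!: derivative_eq_intros simp: energy_variance_def power2_eq_square numeral_2_eq_2 field_simps)
  moreover have "\<forall>\<^sub>F b in nhds \<beta>. energy_U M H b = moment 1 b / moment 0 b"
    using eventually_nhds_greaterThan[OF assms] by eventually_elim (rule energy_U_eq)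
  ultimately show ?thesis
    by (subst DERIV_cong_ev[OF refl _ refl])
qed

lemma energy_U_strict_decreasing:
  assumes "0 < a" "a < b"
  shows "energy_U M H b < energy_U M H a"
proof (rule DERIV_neg_imp_decreasing[OF assms(2)])
  fix x assume "a \<le> x" "x \<le> b"
  then have "0 < x" using assms by simp
  then show "\<exists>y. (energy_U M H has_real_derivative y) (at x) \<and> y < 0"
    using DERIV_energy_U energy_variance_pos by (intro exI[of _ "- energy_variance x"]) simp
qed

section \<open>The essential infimum and the range of the mean energy\<close>

lemma nonzero_volume: "emeasure M (space M) \<noteq> 0"
  using infinite_volume by simp

lemma essinf_nonneg: "0 \<le> essinf M H"
  unfolding essinf_def
  using essinf_well_defined[OF H_measurable H_nonneg nonzero_volume] by (intro cSup_upper)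

text \<open>The supremum defining the essential infimum is attained: the bounds
  \<open>essinf M H - 1 / real (Suc n)\<close> hold almost everywhere, and countably many null sets
  may be united.\<close>

lemma AE_essinf_le: "AE x in M. essinf M H \<le> H x"
proof -
  have "AE x in M. essinf M H - 1 / real (Suc n) \<le> H x" for n
  proof -
    have "essinf M H - 1 / real (Suc n) < essinf M H" by simp
    then obtain c where c: "AE x in M. c \<le> H x" "essinf M H - 1 / real (Suc n) < c"
      using less_cSup_iff[of "{c. AE x in M. c \<le> H x}"]
        essinf_well_defined[OF H_measurable H_nonneg nonzero_volume]
      unfolding essinf_def by blast
    from c(1) show ?thesis by eventually_elim (use c(2) in linarith)
  qed
  then have "AE x in M. \<forall>n. essinf M H - 1 / real (Suc n) \<le> H x"
    by (simp add: AE_all_countable)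
  then show ?thesis
  proof eventually_elim
    case (elim x)
    show ?case
    proof (rule ccontr)
      assume "\<not> essinf M H \<le> H x"
      then obtain n where "1 / real (Suc n) < essinf M H - H x"
        using nat_approx_posE[of "essinf M H - H x"] by auto
      then show False using elim[rule_format, of n] by linarith
    qed
  qed
qed

text \<open>If the sublevel set were null, \<open>E\<close> would be an almost-everywhere lower
  bound above the essential infimum.\<close>

lemma count_N_pos:
  assumes "essinf M H < E"
  shows "0 < enn2real (count_N M H E)"
proof -
  have "emeasure M {x \<in> space M. H x \<le> E} \<noteq> 0"
  proof
    assume "emeasure M {x \<in> space M. H x \<le> E} = 0"
    then have "AE x in M. \<not> H x \<le> E"
      by (subst AE_iff_measurable[OF _ refl]) auto
    then have "AE x in M. E \<le> H x"
      by eventually_elim simp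
    then have "E \<le> essinf M H"
      unfolding essinf_def
      using essinf_well_defined(2)[OF H_measurable H_nonneg nonzero_volume] by (intro cSup_upper) auto
    with assms show False by simp
  qed
  then show ?thesis
    using count_N_finite'[of E] by (simp add: count_N_eq enn2real_positive_iff zero_less_iff_neq_zero)
qed

text \<open>Averaging gives only a weak inequality; comparing with the strictly smaller value of
  \<open>energy_U\<close> at \<open>\<beta> + 1\<close> makes it strict.\<close>

lemma energy_U_gt_essinf:
  assumes "0 < \<beta>"
  shows "essinf M H < energy_U M H \<beta>"
proof -
  have ge: "essinf M H \<le> energy_U M H b" if b: "0 < b" for b
  proof -
    have "(\<integral>x. essinf M H * (H x ^ 0 * exp (- b * H x)) \<partial>M) \<le> moment 1 b"
      unfolding moment_def
    proof (rule integral_mono_AE)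
      show "AE x in M. essinf M H * (H x ^ 0 * exp (- b * H x)) \<le> H x ^ 1 * exp (- b * H x)"
        using AE_essinf_le by eventually_elim simp
    qed (intro integrable_mult_right integrable_moment b)+
    then have "essinf M H * moment 0 b \<le> moment 1 b"
      by (simp add: moment_def)
    then show ?thesis
      using moment_0_pos[OF b] by (simp add: energy_U_eq[OF b] pos_le_divide_eq)
  qed
  have "essinf M H \<le> energy_U M H (\<beta> + 1)"
    using assms by (intro ge) simp
  also have "\<dots> < energy_U M H \<beta>"
    using assms by (intro energy_U_strict_decreasing) auto
  finally show ?thesis .
qed

lemma Psi_lower_bound:
  assumes "0 < \<beta>" "0 < enn2real (count_N M H E)"
  shows "ln (enn2real (count_N M H E)) - \<beta> * E \<le> Psi M H \<beta>"
proof -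
  have "ln (exp (- \<beta> * E) * enn2real (count_N M H E)) \<le> Psi M H \<beta>"
    unfolding Psi_eq using partition_Z_lower_bound[OF assms(1), of E] assms(2)
    by (intro ln_mono) auto
  then show ?thesis
    using assms(2) by (simp add: ln_mult)
qed

lemma DERIV_Psi_plus_linear:
  assumes "0 < \<beta>"
  shows "((\<lambda>\<beta>. Psi M H \<beta> + \<beta> * E) has_field_derivative E - energy_U M H \<beta>) (at \<beta>)"
  using DERIV_Psi'[OF assms] by (auto intro!: derivative_eq_intros)

text \<open>The function \<open>\<phi>\<close> has derivative
  \<open>E - energy_U M H \<beta>\<close>. If the mean energy stayed on one side of
  \<open>E\<close>, \<open>\<phi>\<close> would be monotone and so bounded above by
  \<open>\<phi> 1\<close> on one side of 1, but it is unbounded above both near 0 and near infinity.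
  The intermediate value theorem finishes the proof.\<close>

lemma energy_U_surj:
  assumes "essinf M H < E"
  shows "\<exists>\<beta>>0. energy_U M H \<beta> = E"
proof -
  define \<phi> where "\<phi> \<beta> = Psi M H \<beta> + \<beta> * E" for \<beta>
  have D: "(\<phi> has_field_derivative E - energy_U M H \<beta>) (at \<beta>)" if "0 < \<beta>" for \<beta>
    unfolding \<phi>_def[abs_def] by (rule DERIV_Psi_plus_linear[OF that])
  have "0 \<le> E" using assms essinf_nonneg by simp
  have "\<exists>b>0. E < energy_U M H b"
  proof (rule ccontr)
    assume "\<not> ?thesis"
    then have le: "energy_U M H b \<le> E" if "0 < b" for b using that by (meson not_less)
    \<comment> \<open>The level \<open>E1\<close> is so large that, even after the loss
      \<open>b * E1\<close>, which is at most 1 for the \<open>b\<close> below,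
      \<open>\<phi> b\<close> exceeds \<open>\<phi> 1\<close>.\<close>
    obtain E1 where E1: "0 \<le> E1" "exp (\<phi> 1 + 1) < enn2real (count_N M H E1)"
      using count_N_unbounded[of "exp (\<phi> 1 + 1)"] by auto
    define b where "b = 1 / (E1 + 1)"
    have b: "0 < b" "b \<le> 1" "b * E1 \<le> 1"
      using E1(1) by (auto simp: b_def field_simps)
    have "\<phi> b \<le> \<phi> 1"
    proof (rule DERIV_nonneg_imp_nondecreasing[OF b(2)])
      fix x assume "b \<le> x" "x \<le> 1"
      then show "\<exists>y. (\<phi> has_real_derivative y) (at x) \<and> 0 \<le> y"
        using b D[of x] le[of x] by (intro exI[of _ "E - energy_U M H x"]) simp
    qed
    moreover have "\<phi> 1 + 1 < ln (enn2real (count_N M H E1))"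
      using E1(2) by (smt (verit) exp_gt_zero ln_exp ln_less_cancel_iff)
    moreover have "ln (enn2real (count_N M H E1)) - b * E1 \<le> Psi M H b"
      using E1(2) b(1) by (intro Psi_lower_bound) (smt (verit) exp_gt_zero)+
    moreover have "0 \<le> b * E" using b \<open>0 \<le> E\<close> by simp
    ultimately show False
      using b(3) unfolding \<phi>_def by linarith
  qed
  then obtain b1 where b1: "0 < b1" "E < energy_U M H b1" by blast
  have "\<exists>b>0. energy_U M H b < E"
  proof (rule ccontr)
    assume "\<not> ?thesis"
    then have ge: "E \<le> energy_U M H b" if "0 < b" for b using that by (meson not_less)
    \<comment> \<open>A level strictly between the essential infimum and \<open>E\<close>: its
      sublevel set has positive measure, and \<open>\<phi> b\<close> is at least
      \<open>l + b * (E - E1)\<close>, which grows linearly in \<open>b\<close>.\<close>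
    define E1 where "E1 = (essinf M H + E) / 2"
    define l where "l = ln (enn2real (count_N M H E1))"
    have E1: "essinf M H < E1" "E1 < E" using assms by (auto simp: E1_def)
    \<comment> \<open>Large enough that the linear lower bound reaches \<open>\<phi> 1 + 1\<close>,
      and at least 1 so that monotonicity applies from 1 to \<open>b\<close>.\<close>
    define b where "b = max 1 ((\<phi> 1 + 1 - l) / (E - E1))"
    have b: "1 \<le> b" "\<phi> 1 + 1 - l \<le> b * (E - E1)"
      using E1 by (auto simp: b_def pos_divide_le_eq[symmetric])
    have "\<phi> b \<le> \<phi> 1"
    proof (rule DERIV_nonpos_imp_nonincreasing[OF b(1)])
      fix x assume "1 \<le> x" "x \<le> b"
      then show "\<exists>y. (\<phi> has_real_derivative y) (at x) \<and> y \<le> 0"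
        using D[of x] ge[of x] by (intro exI[of _ "E - energy_U M H x"]) simp
    qed
    moreover have "l - b * E1 \<le> Psi M H b"
      unfolding l_def using b(1) count_N_pos[OF E1(1)] by (intro Psi_lower_bound) auto
    ultimately show False
      using b(2) unfolding \<phi>_def by (simp add: right_diff_distrib)
  qed
  then obtain b2 where b2: "0 < b2" "energy_U M H b2 < E" by blast
  have "b1 \<le> b2"
    using energy_U_strict_decreasing[OF b2(1), of b1] b1 b2 by (cases "b1 \<le> b2") auto
  then obtain x where "b1 \<le> x" "energy_U M H x = E"
    using IVT2[of "energy_U M H" b2 E b1] b1 b2 DERIV_isCont[OF DERIV_energy_U]
    by (metis less_imp_le less_le_trans)
  then show ?thesis
    using b1(1) by (intro exI[of _ x]) simp
qed

lemma energy_U_bij: "bij_betw (energy_U M H) {0<..} {essinf M H<..}"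
proof (rule bij_betw_imageI)
  show "inj_on (energy_U M H) {0<..}"
    by (rule linorder_inj_onI) (use energy_U_strict_decreasing in \<open>force intro: linear\<close>)+
  show "energy_U M H ` {0<..} = {essinf M H<..}"
    using energy_U_gt_essinf energy_U_surj by (auto simp: image_iff)
qed

text \<open>The derivative at \<open>z\<close> is \<open>energy_U M H a - energy_U M H z\<close>,
  which changes sign exactly at \<open>a\<close> since the mean energy strictly decreases; the mean
  value theorem is applied on either side.\<close>

lemma Psi_plus_linear_unique_min:
  assumes "0 < a" "0 < b" "b \<noteq> a"
  shows "Psi M H a + a * energy_U M H a < Psi M H b + b * energy_U M H a"
proof -
  let ?\<phi> = "\<lambda>\<beta>. Psi M H \<beta> + \<beta> * energy_U M H a"
  show ?thesis
  proof (cases "a < b")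
    case True
    obtain z where z: "a < z" "z < b" "?\<phi> b - ?\<phi> a = (b - a) * (energy_U M H a - energy_U M H z)"
      using MVT2[OF True, of ?\<phi> "\<lambda>z. energy_U M H a - energy_U M H z"] DERIV_Psi_plus_linear assms by force
    then have "0 < ?\<phi> b - ?\<phi> a"
      using energy_U_strict_decreasing[of a z] assms True by simp
    then show ?thesis by simp
  next
    case False
    then have ba: "b < a" using assms by simp
    obtain z where z: "b < z" "z < a" "?\<phi> a - ?\<phi> b = (a - b) * (energy_U M H a - energy_U M H z)"
      using MVT2[OF ba, of ?\<phi> "\<lambda>z. energy_U M H a - energy_U M H z"] DERIV_Psi_plus_linear assms by force
    then have "?\<phi> a - ?\<phi> b < 0"
      using energy_U_strict_decreasing[of z a] assms ba by (simp add: mult_pos_neg)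
    then show ?thesis by simp
  qed
qed

subsection \<open>Volume of the sublevel sets of the total energy\<close>

sublocale product_sigma_finite "\<lambda>_::nat. M"
  by unfold_locales

lemma volume_set_measurable [measurable]:
  "{x \<in> space (\<Pi>\<^sub>M i\<in>{1..n}. M). H_sum H n x \<le> c} \<in> sets (\<Pi>\<^sub>M i\<in>{1..n}. M)"
  unfolding H_sum_def by measurable

lemma prod_exp_H: "(\<Prod>i\<in>{1..n}. exp (- \<beta> * H (x i))) = exp (- \<beta> * H_sum H n x)"
  by (simp add: H_sum_def exp_sum sum_distrib_left)

text \<open>The weight of a sum of energies factorises over the coordinates, so Fubini turns the
  integral into a power.\<close>

lemma Boltzmann_weight_product:
  assumes "0 < \<beta>"
  shows "integrable (\<Pi>\<^sub>M i\<in>{1..n}. M) (\<lambda>x. exp (- \<beta> * H_sum H n x))"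
    and "(\<integral>x. exp (- \<beta> * H_sum H n x) \<partial>(\<Pi>\<^sub>M i\<in>{1..n}. M)) = moment 0 \<beta> ^ n"
proof -
  show "integrable (\<Pi>\<^sub>M i\<in>{1..n}. M) (\<lambda>x. exp (- \<beta> * H_sum H n x))"
    unfolding prod_exp_H[symmetric]
    by (rule product_integrable_prod) (use integrable_exp_H[OF assms] in auto)
  show "(\<integral>x. exp (- \<beta> * H_sum H n x) \<partial>(\<Pi>\<^sub>M i\<in>{1..n}. M)) = moment 0 \<beta> ^ n"
    unfolding prod_exp_H[symmetric]
    by (subst product_integral_prod) (use integrable_exp_H[OF assms] in \<open>auto simp: moment_def\<close>)
qed

text \<open>Chernoff: the indicator of the sublevel set is at most
  \<open>exp (\<beta> * (n * E - H_sum H n x))\<close>, whose integral factorises.\<close>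

lemma volume_A_upper_bound:
  assumes \<beta>: "0 < \<beta>"
  shows "volume_A M H n E \<le> ennreal (exp (real n * (Psi M H \<beta> + \<beta> * E)))"
proof -
  let ?P = "\<Pi>\<^sub>M i\<in>{1..n}. M"
  let ?A = "{x \<in> space ?P. H_sum H n x \<le> real n * E}"
  let ?g = "\<lambda>x. exp (\<beta> * real n * E) * exp (- \<beta> * H_sum H n x)"
  have "volume_A M H n E = (\<integral>\<^sup>+ x. indicator ?A x \<partial>?P)"
    unfolding volume_A_def by (rule nn_integral_indicator[symmetric]) (rule volume_set_measurable)
  also have "\<dots> \<le> (\<integral>\<^sup>+ x. ennreal (?g x) \<partial>?P)"
  proof (rule nn_integral_mono)
    fix x
    show "indicator ?A x \<le> ennreal (?g x)"
    proof (cases "x \<in> ?A")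
      case True
      then have "\<beta> * H_sum H n x \<le> \<beta> * (real n * E)"
        using \<beta> by (intro mult_left_mono) auto
      then have "1 \<le> ?g x"
        by (simp add: exp_add[symmetric] algebra_simps)
      then show ?thesis
        using True by (simp add: ennreal_leI)
    qed simp
  qed
  also have "\<dots> = ennreal (\<integral>x. ?g x \<partial>?P)"
    by (intro nn_integral_eq_integral integrable_mult_right Boltzmann_weight_product \<beta>) auto
  also have "(\<integral>x. ?g x \<partial>?P) = exp (\<beta> * real n * E) * moment 0 \<beta> ^ n"
    using Boltzmann_weight_product[OF \<beta>, of n] by simp
  also have "\<dots> = exp (real n * (Psi M H \<beta> + \<beta> * E))"
    using moment_0_pos[OF \<beta>]
    by (simp add: Psi_eq distrib_left exp_add exp_of_nat_mult[symmetric] exp_of_nat_mult ac_simps)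
  finally show ?thesis .
qed

lemma volume_A_finite: "volume_A M H n E < \<infinity>"
  using volume_A_upper_bound[of 1 n E] by (simp add: order.strict_trans1)

lemma ennreal_volume_A: "ennreal (enn2real (volume_A M H n E)) = volume_A M H n E"
  using volume_A_finite[of n E] by (simp add: less_top)

text \<open>The cube over the one-particle sublevel set at \<open>E\<close> lies in the sublevel set
  of the total energy.\<close>

lemma volume_A_ge_count_N_power: "(count_N M H E) ^ n \<le> volume_A M H n E"
proof -
  let ?A = "{x \<in> space M. H x \<le> E}"
  have "(count_N M H E) ^ n = emeasure (\<Pi>\<^sub>M i\<in>{1..n}. M) (\<Pi>\<^sub>E i\<in>{1..n}. ?A)"
    by (subst emeasure_PiM) (auto simp: count_N_eq)
  also have "\<dots> \<le> volume_A M H n E"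
    unfolding volume_A_def
  proof (rule emeasure_mono)
    show "(\<Pi>\<^sub>E i\<in>{1..n}. ?A) \<subseteq> {x \<in> space (\<Pi>\<^sub>M i\<in>{1..n}. M). H_sum H n x \<le> real n * E}"
    proof
      fix x assume x: "x \<in> (\<Pi>\<^sub>E i\<in>{1..n}. ?A)"
      have "H_sum H n x \<le> (\<Sum>i\<in>{1..n}. E)"
        unfolding H_sum_def using x by (intro sum_mono) (auto simp: PiE_iff)
      then show "x \<in> {x \<in> space (\<Pi>\<^sub>M i\<in>{1..n}. M). H_sum H n x \<le> real n * E}"
        using x by (auto simp: space_PiM PiE_iff)
    qed
  qed (rule volume_set_measurable)
  finally show ?thesis .
qed

lemma volume_A_pos:
  assumes "essinf M H < E"
  shows "0 < volume_A M H n E"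
proof -
  have "0 < count_N M H E ^ n"
    using count_N_pos[OF assms] by (metis enn2real_positive_iff not_gr_zero power_not_zero)
  then show ?thesis
    using volume_A_ge_count_N_power[of E n] by simp
qed

text \<open>Under the Gibbs weight the coordinates are independent and \<open>u\<close> is the mean
  of each energy, so distinct coordinates are uncorrelated. No normalisation is made, hence the
  power of \<open>moment 0 \<beta>\<close>.\<close>

lemma centred_product_moment:
  fixes n :: nat
  assumes \<beta>: "0 < \<beta>" and ij: "i \<in> {1..n}" "j \<in> {1..n}"
  defines "u \<equiv> energy_U M H \<beta>"
  shows "integrable (\<Pi>\<^sub>M i\<in>{1..n}. M)
           (\<lambda>x. (H (x i) - u) * (H (x j) - u) * exp (- \<beta> * H_sum H n x))"
    and "(\<integral>x. (H (x i) - u) * (H (x j) - u) * exp (- \<beta> * H_sum H n x) \<partial>(\<Pi>\<^sub>M i\<in>{1..n}. M))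
         = (if i = j then energy_variance \<beta> * moment 0 \<beta> ^ n else 0)"
proof -
  \<comment> \<open>Coordinate \<open>k\<close> receives one centring factor for each of
    \<open>i\<close> and \<open>j\<close> equal to it, so the diagonal case produces the square by
    itself.\<close>
  define f where "f k y = (if k = i then H y - u else 1) * (if k = j then H y - u else 1)
    * exp (- \<beta> * H y)" for k y
  note int = integrable_moment[OF \<beta>]
  have int1: "integrable M (\<lambda>y. (H y - u) * exp (- \<beta> * H y))"
    and integral1: "(\<integral>y. (H y - u) * exp (- \<beta> * H y) \<partial>M) = 0"
  proof -
    have eq: "(H y - u) * exp (- \<beta> * H y) = H y ^ 1 * exp (- \<beta> * H y) - u * (H y ^ 0 * exp (- \<beta> * H y))" for y
      by (simp add: algebra_simps)
    show "integrable M (\<lambda>y. (H y - u) * exp (- \<beta> * H y))"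
      unfolding eq by (intro Bochner_Integration.integrable_diff integrable_mult_right int)
    have "(\<integral>y. (H y - u) * exp (- \<beta> * H y) \<partial>M) = moment 1 \<beta> - u * moment 0 \<beta>"
      unfolding eq moment_def
      by (subst Bochner_Integration.integral_diff) (intro integrable_mult_right int | simp)+
    also have "\<dots> = 0"
      using moment_0_pos[OF \<beta>] by (simp add: u_def energy_U_eq[OF \<beta>])
    finally show "(\<integral>y. (H y - u) * exp (- \<beta> * H y) \<partial>M) = 0" .
  qed
  have f_int: "integrable M (f k)" for k
    unfolding f_def
    using int1 moment_variance(1)[OF \<beta>, of u] integrable_exp_H[OF \<beta>]
    by (cases "k = i"; cases "k = j") (auto simp: power2_eq_square)
  have eq: "(H (x i) - u) * (H (x j) - u) * exp (- \<beta> * H_sum H n x) = (\<Prod>k\<in>{1..n}. f k (x k))" for x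
    using ij unfolding f_def prod.distrib prod_exp_H by (simp add: prod.delta)
  show "integrable (\<Pi>\<^sub>M i\<in>{1..n}. M)
           (\<lambda>x. (H (x i) - u) * (H (x j) - u) * exp (- \<beta> * H_sum H n x))"
    unfolding eq by (rule product_integrable_prod) (use f_int in auto)
  have "(\<integral>x. (\<Prod>k\<in>{1..n}. f k (x k)) \<partial>(\<Pi>\<^sub>M i\<in>{1..n}. M)) = (\<Prod>k\<in>{1..n}. integral\<^sup>L M (f k))"
    by (rule product_integral_prod) (use f_int in auto)
  \<comment> \<open>Factor \<open>i\<close> decides the product: it vanishes off the diagonal and is
    the unnormalised variance on it.\<close>
  also have "\<dots> = integral\<^sup>L M (f i) * (\<Prod>k\<in>{1..n} - {i}. integral\<^sup>L M (f k))"
    using ij by (intro prod.remove) auto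
  also have "\<dots> = (if i = j then energy_variance \<beta> * moment 0 \<beta> ^ n else 0)"
  proof (cases "i = j")
    case True
    have "integral\<^sup>L M (f i) = moment 2 \<beta> - 2 * u * moment 1 \<beta> + u\<^sup>2 * moment 0 \<beta>"
      using moment_variance(2)[OF \<beta>, of u] True by (simp add: f_def[abs_def] power2_eq_square)
    also have "\<dots> = energy_variance \<beta> * moment 0 \<beta>"
      using moment_0_pos[OF \<beta>]
      by (simp add: u_def energy_U_eq[OF \<beta>] energy_variance_def field_simps power2_eq_square)
    finally have "integral\<^sup>L M (f i) = energy_variance \<beta> * moment 0 \<beta>" .
    moreover have "(\<Prod>k\<in>{1..n} - {i}. integral\<^sup>L M (f k)) = (\<Prod>k\<in>{1..n} - {i}. moment 0 \<beta>)"
      using True by (intro prod.cong) (auto simp: f_def[abs_def] moment_def)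
    moreover have "n = Suc (n - 1)"
      using ij by simp
    ultimately show ?thesis
      using True ij by (simp add: power_Suc[symmetric] mult.assoc del: power_Suc)
  next
    case False
    then have "integral\<^sup>L M (f i) = 0"
      using integral1 by (simp add: f_def[abs_def])
    then show ?thesis using False by simp
  qed
  finally show "(\<integral>x. (H (x i) - u) * (H (x j) - u) * exp (- \<beta> * H_sum H n x) \<partial>(\<Pi>\<^sub>M i\<in>{1..n}. M))
         = (if i = j then energy_variance \<beta> * moment 0 \<beta> ^ n else 0)"
    unfolding eq .
qed

text \<open>The variance of a sum of independent terms: in the expanded square only the
  \<open>n\<close> diagonal terms survive.\<close>

lemma H_sum_variance:
  assumes \<beta>: "0 < \<beta>"
  defines "u \<equiv> energy_U M H \<beta>"
  shows "integrable (\<Pi>\<^sub>M i\<in>{1..n}. M) (\<lambda>x. (H_sum H n x - real n * u)\<^sup>2 * exp (- \<beta> * H_sum H n x))"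
    and "(\<integral>x. (H_sum H n x - real n * u)\<^sup>2 * exp (- \<beta> * H_sum H n x) \<partial>(\<Pi>\<^sub>M i\<in>{1..n}. M))
         = real n * energy_variance \<beta> * moment 0 \<beta> ^ n"
proof -
  have "H_sum H n x - real n * u = (\<Sum>i\<in>{1..n}. H (x i) - u)" for x
    by (simp add: H_sum_def sum_subtractf)
  then have eq: "(H_sum H n x - real n * u)\<^sup>2 * exp (- \<beta> * H_sum H n x)
      = (\<Sum>i\<in>{1..n}. \<Sum>j\<in>{1..n}. (H (x i) - u) * (H (x j) - u) * exp (- \<beta> * H_sum H n x))" for x
    by (simp only: power2_eq_square sum_product) (simp only: sum_distrib_right)
  note cpm = centred_product_moment[OF \<beta>, folded u_def]
  show "integrable (\<Pi>\<^sub>M i\<in>{1..n}. M) (\<lambda>x. (H_sum H n x - real n * u)\<^sup>2 * exp (- \<beta> * H_sum H n x))"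
    unfolding eq by (intro Bochner_Integration.integrable_sum cpm)
  have "(\<integral>x. (H_sum H n x - real n * u)\<^sup>2 * exp (- \<beta> * H_sum H n x) \<partial>(\<Pi>\<^sub>M i\<in>{1..n}. M))
      = (\<Sum>i\<in>{1..n}. \<integral>x. (\<Sum>j\<in>{1..n}. (H (x i) - u) * (H (x j) - u) * exp (- \<beta> * H_sum H n x)) \<partial>(\<Pi>\<^sub>M i\<in>{1..n}. M))"
    unfolding eq
    by (rule Bochner_Integration.integral_sum) (intro Bochner_Integration.integrable_sum cpm)
  also have "\<dots> = (\<Sum>i\<in>{1..n}. \<Sum>j\<in>{1..n}. if i = j then energy_variance \<beta> * moment 0 \<beta> ^ n else 0)"
  proof (rule sum.cong[OF refl])
    fix i assume i: "i \<in> {1..n}"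
    have "(\<integral>x. (\<Sum>j\<in>{1..n}. (H (x i) - u) * (H (x j) - u) * exp (- \<beta> * H_sum H n x)) \<partial>(\<Pi>\<^sub>M i\<in>{1..n}. M))
        = (\<Sum>j\<in>{1..n}. \<integral>x. (H (x i) - u) * (H (x j) - u) * exp (- \<beta> * H_sum H n x) \<partial>(\<Pi>\<^sub>M i\<in>{1..n}. M))"
      by (rule Bochner_Integration.integral_sum) (intro cpm i)
    also have "\<dots> = (\<Sum>j\<in>{1..n}. if i = j then energy_variance \<beta> * moment 0 \<beta> ^ n else 0)"
      by (intro sum.cong refl cpm i)
    finally show "(\<integral>x. (\<Sum>j\<in>{1..n}. (H (x i) - u) * (H (x j) - u) * exp (- \<beta> * H_sum H n x)) \<partial>(\<Pi>\<^sub>M i\<in>{1..n}. M))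
        = (\<Sum>j\<in>{1..n}. if i = j then energy_variance \<beta> * moment 0 \<beta> ^ n else 0)" .
  qed
  also have "\<dots> = real n * energy_variance \<beta> * moment 0 \<beta> ^ n"
    by simp
  finally show "(\<integral>x. (H_sum H n x - real n * u)\<^sup>2 * exp (- \<beta> * H_sum H n x) \<partial>(\<Pi>\<^sub>M i\<in>{1..n}. M))
         = real n * energy_variance \<beta> * moment 0 \<beta> ^ n" .
qed

text \<open>On the shell where \<open>H_sum H n x\<close> differs from \<open>n * u\<close> by at
  most \<open>n * \<delta>\<close>, the Boltzmann weight is at most
  \<open>exp (- \<beta> * n * (u - \<delta>))\<close>. The volume of the shell is therefore at least
  its Boltzmann mass divided by this bound, and most of the Boltzmann mass lies there once
  \<open>n\<close> is large.\<close>

lemma volume_A_lower_bound: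
  assumes \<beta>: "0 < \<beta>" and \<delta>: "0 < \<delta>" and n: "1 \<le> n"
  defines "u \<equiv> energy_U M H \<beta>"
  shows "exp (real n * (Psi M H \<beta> + \<beta> * (u - \<delta>))) * (1 - energy_variance \<beta> / (real n * \<delta>\<^sup>2))
         \<le> enn2real (volume_A M H n (u + \<delta>))"
proof -
  let ?P = "\<Pi>\<^sub>M i\<in>{1..n}. M"
  let ?A = "{x \<in> space ?P. H_sum H n x \<le> real n * (u + \<delta>)}"
  let ?w = "\<lambda>x. exp (- \<beta> * H_sum H n x)"
  let ?c = "exp (real n * (\<beta> * (u - \<delta>)))"
  \<comment> \<open>Chebyshev: \<open>1 - (H\<^sub>n - nu)\<^sup>2 / (n\<delta>)\<^sup>2\<close> bounds the indicator of \<open>\<bar>H\<^sub>n - nu\<bar> \<le> n\<delta>\<close> from below.\<close>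
  define g where "g x = ?c * (?w x - 1 / (real n * \<delta>)\<^sup>2 * ((H_sum H n x - real n * u)\<^sup>2 * ?w x))" for x
  note hs = H_sum_variance[OF \<beta>, of n, folded u_def]
  note bw = Boltzmann_weight_product[OF \<beta>, of n]
  have nd: "0 < real n * \<delta>" using n \<delta> by simp
  have g_le: "g x \<le> indicator ?A x" if x: "x \<in> space ?P" for x
  proof -
    define t where "t = H_sum H n x - real n * u"
    have g: "g x = ?c * ?w x * (1 - t\<^sup>2 / (real n * \<delta>)\<^sup>2)"
      by (simp add: g_def t_def right_diff_distrib)
    show ?thesis
    proof (cases "\<bar>t\<bar> \<le> real n * \<delta>")
      case True
      then have t: "- (real n * \<delta>) \<le> t" "t \<le> real n * \<delta>" by auto
      then have "x \<in> ?A" using x by (simp add: t_def algebra_simps)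
      have "g x \<le> ?c * ?w x * 1"
        unfolding g by (intro mult_left_mono) auto
      also have "?c * ?w x = exp (\<beta> * (- (real n * \<delta>) - t))"
        by (simp add: exp_add[symmetric] t_def algebra_simps)
      also have "\<dots> \<le> 1"
        using \<beta> t by (simp add: mult_nonneg_nonpos)
      finally show ?thesis using \<open>x \<in> ?A\<close> by simp
    next
      case False
      then have "(real n * \<delta>)\<^sup>2 \<le> t\<^sup>2"
        using nd by (simp add: abs_le_square_iff[symmetric])
      then have "1 \<le> t\<^sup>2 / (real n * \<delta>)\<^sup>2"
        by (subst pos_le_divide_eq[OF zero_less_power[OF nd]]) simp
      \<comment> \<open>Outside the shell \<open>g\<close> is non-positive, so it lies below the
        indicator whichever value that takes.\<close>
      then have "g x \<le> 0"
        unfolding g by (intro mult_nonneg_nonpos) (auto simp del: power_mult_distrib)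
      then show ?thesis by (simp add: indicator_def)
    qed
  qed
  have "(\<integral>x. g x \<partial>?P) \<le> (\<integral>x. indicator ?A x \<partial>?P)"
  proof (rule integral_mono)
    show "integrable ?P g"
      unfolding g_def
      by (intro integrable_mult_right Bochner_Integration.integrable_diff hs bw)
    show "integrable ?P (indicator ?A :: _ \<Rightarrow> real)"
      using volume_A_finite[of n "u + \<delta>"] unfolding volume_A_def
      by (intro integrable_real_indicator volume_set_measurable)
  qed (rule g_le)
  also have "\<dots> = enn2real (volume_A M H n (u + \<delta>))"
  proof -
    have "?A \<inter> space ?P = ?A" by blast
    then show ?thesis by (simp add: volume_A_def measure_def)
  qed
  also have "(\<integral>x. g x \<partial>?P)
      = ?c * (moment 0 \<beta> ^ n - 1 / (real n * \<delta>)\<^sup>2 * (real n * energy_variance \<beta> * moment 0 \<beta> ^ n))"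
    unfolding g_def
    by (subst integral_mult_right_zero, subst Bochner_Integration.integral_diff)
       (intro integrable_mult_right hs bw | simp only: integral_mult_right_zero hs bw)+
  also have "\<dots> = ?c * moment 0 \<beta> ^ n * (1 - energy_variance \<beta> / (real n * \<delta>\<^sup>2))"
    using n \<delta> by (simp add: field_simps power2_eq_square)
  also have "?c * moment 0 \<beta> ^ n = exp (real n * (Psi M H \<beta> + \<beta> * (u - \<delta>)))"
    using moment_0_pos[OF \<beta>] by (simp add: Psi_eq distrib_left exp_add exp_of_nat_mult)
  finally show ?thesis .
qed

section \<open>Exponential growth rate of the volumes\<close>

lemma log_volume_upper_bound:
  assumes "essinf M H < E" "0 < \<beta>" "1 \<le> n"
  shows "log_volume M H n E \<le> Psi M H \<beta> + \<beta> * E"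
proof -
  have pos: "0 < enn2real (volume_A M H n E)"
    using volume_A_pos[OF assms(1)] volume_A_finite by (simp add: enn2real_positive_iff)
  have "enn2real (volume_A M H n E) \<le> exp (real n * (Psi M H \<beta> + \<beta> * E))"
    using volume_A_upper_bound[OF assms(2), of n E] enn2real_leI by (metis exp_ge_zero)
  then have "ln (enn2real (volume_A M H n E)) \<le> real n * (Psi M H \<beta> + \<beta> * E)"
    using pos by (metis exp_gt_zero ln_exp ln_le_cancel_iff)
  then show ?thesis
    using assms(3) by (simp add: log_volume_def field_simps)
qed

lemma log_volume_ge_log_count_N:
  assumes "essinf M H < E" "1 \<le> n"
  shows "ln (enn2real (count_N M H E)) \<le> log_volume M H n E"
proof -
  have "ennreal (enn2real (count_N M H E) ^ n) \<le> ennreal (enn2real (volume_A M H n E))"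
    using volume_A_ge_count_N_power[of E n]
    by (simp add: ennreal_power[symmetric] ennreal_count_N ennreal_volume_A)
  then have "enn2real (count_N M H E) ^ n \<le> enn2real (volume_A M H n E)"
    by (subst (asm) ennreal_le_iff) auto
  then have "ln (enn2real (count_N M H E) ^ n) \<le> ln (enn2real (volume_A M H n E))"
    using count_N_pos[OF assms(1)] by (intro ln_mono) auto
  then show ?thesis
    using assms(2) count_N_pos[OF assms(1)] by (simp add: log_volume_def ln_realpow field_simps)
qed

text \<open>With \<open>\<delta> = E - u\<close> the exponent of the Chebyshev bound contains
  \<open>u - \<delta> = 2 * u - E\<close>. Its correction factor is eventually at least 1/2, which
  costs only \<open>ln 2 / n\<close> in the logarithm.\<close>

lemma eventually_log_volume_lower_bound:
  assumes \<beta>: "0 < \<beta>" and E: "energy_U M H \<beta> < E"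
    and a: "a < Psi M H \<beta> + \<beta> * (2 * energy_U M H \<beta> - E)"
  shows "\<forall>\<^sub>F n in sequentially. a < log_volume M H n E"
proof -
  define u where "u = energy_U M H \<beta>"
  define \<delta> where "\<delta> = E - u"
  define h where "h = Psi M H \<beta> + \<beta> * (u - \<delta>)"
  have \<delta>: "0 < \<delta>" using E by (simp add: \<delta>_def u_def)
  have ah: "0 < h - a" using a by (simp add: h_def u_def \<delta>_def)
  have "(\<lambda>n. energy_variance \<beta> / (real n * \<delta>\<^sup>2)) \<longlonglongrightarrow> 0"
    using lim_const_over_n[of "energy_variance \<beta> / \<delta>\<^sup>2"] by (simp add: mult.commute)
  then have "\<forall>\<^sub>F n in sequentially. energy_variance \<beta> / (real n * \<delta>\<^sup>2) < 1 / 2"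
    by (rule order_tendstoD) simp
  moreover have "(\<lambda>n. ln 2 / real n) \<longlonglongrightarrow> 0"
    by (rule lim_const_over_n)
  then have "\<forall>\<^sub>F n in sequentially. ln 2 / real n < h - a"
    using ah by (rule order_tendstoD)
  ultimately show ?thesis
    using eventually_ge_at_top[of 1]
  proof eventually_elim
    case (elim n)
    have "exp (real n * h) * (1 / 2) \<le> exp (real n * h) * (1 - energy_variance \<beta> / (real n * \<delta>\<^sup>2))"
      using elim(1) by (intro mult_left_mono) auto
    also have "\<dots> \<le> enn2real (volume_A M H n E)"
      using volume_A_lower_bound[OF \<beta> \<delta> elim(3)] by (simp add: h_def \<delta>_def u_def)
    finally have "ln (exp (real n * h) * (1 / 2)) \<le> ln (enn2real (volume_A M H n E))"
      by (intro ln_mono) auto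
    then have "real n * h - ln 2 \<le> ln (enn2real (volume_A M H n E))"
      by (simp add: ln_mult ln_div)
    then have "(real n * h - ln 2) / real n \<le> log_volume M H n E"
      unfolding log_volume_def by (rule divide_right_mono) simp
    then have "h - ln 2 / real n \<le> log_volume M H n E"
      using elim(3) by (simp add: diff_divide_distrib)
    then show ?case using elim(2) by linarith
  qed
qed

text \<open>Chernoff bounds the sequence from above at \<open>\<beta>\<close> itself. The lower
  bound needs a mean energy strictly below \<open>E\<close>, hence a parameter slightly larger than
  \<open>\<beta>\<close>.\<close>

lemma log_volume_tendsto:
  assumes \<beta>: "0 < \<beta>"
  defines "E \<equiv> energy_U M H \<beta>"
  shows "(\<lambda>n. log_volume M H n E) \<longlonglongrightarrow> Psi M H \<beta> + \<beta> * E"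
proof (rule order_tendstoI)
  have E: "essinf M H < E" unfolding E_def by (rule energy_U_gt_essinf[OF \<beta>])
  show "\<forall>\<^sub>F n in sequentially. log_volume M H n E < a" if "Psi M H \<beta> + \<beta> * E < a" for a
    using eventually_ge_at_top[of 1] by eventually_elim (use log_volume_upper_bound[OF E \<beta>] that in force)
  show "\<forall>\<^sub>F n in sequentially. a < log_volume M H n E" if a: "a < Psi M H \<beta> + \<beta> * E" for a
  proof -
    \<comment> \<open>The exponent of the lower bound at parameter \<open>b\<close>; at
      \<open>b = \<beta>\<close>, where the mean energy is \<open>E\<close>, it equals the claimed
      limit.\<close>
    let ?h = "\<lambda>b. Psi M H b + b * (2 * energy_U M H b - E)"
    have "isCont ?h \<beta>"
      using DERIV_isCont[OF DERIV_Psi'[OF \<beta>]] DERIV_isCont[OF DERIV_energy_U[OF \<beta>]]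
      by (intro continuous_intros)
    then have "(?h \<longlongrightarrow> ?h \<beta>) (at_right \<beta>)"
      by (meson continuous_within isCont_def filterlim_at_split)
    then have "\<forall>\<^sub>F b in at_right \<beta>. a < ?h b"
      by (rule order_tendstoD) (use a in \<open>simp add: E_def\<close>)
    then have "\<forall>\<^sub>F b in at_right \<beta>. a < ?h b \<and> \<beta> < b"
      using eventually_at_right_less[of \<beta>] by (rule eventually_conj)
    then obtain b where b: "a < ?h b" "\<beta> < b"
      using eventually_happens[of _ "at_right \<beta>"] by auto
    then show ?thesis
      using \<beta> energy_U_strict_decreasing[OF \<beta> b(2)]
      by (intro eventually_log_volume_lower_bound[of b]) (auto simp: E_def)
  qed
qed

subsection \<open>Legendre duality\<close>

text \<open>Turns out to be the derivative of the entropy.\<close>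

definition inverse_temperature :: "real \<Rightarrow> real" where
  "inverse_temperature = inv_into {0<..} (energy_U M H)"

lemma inverse_temperature_bij: "bij_betw inverse_temperature {essinf M H<..} {0<..}"
  unfolding inverse_temperature_def by (rule bij_betw_inv_into[OF energy_U_bij])

lemma inverse_temperature_pos: "essinf M H < E \<Longrightarrow> 0 < inverse_temperature E"
  using bij_betwE[OF inverse_temperature_bij] by auto

lemma energy_U_inverse_temperature: "essinf M H < E \<Longrightarrow> energy_U M H (inverse_temperature E) = E"
  unfolding inverse_temperature_def by (rule bij_betw_inv_into_right[OF energy_U_bij]) simp

lemma inverse_temperature_energy_U: "0 < \<beta> \<Longrightarrow> inverse_temperature (energy_U M H \<beta>) = \<beta>"
  unfolding inverse_temperature_def by (rule bij_betw_inv_into_left[OF energy_U_bij]) simp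

lemma isCont_inverse_temperature:
  assumes E: "essinf M H < E"
  shows "isCont inverse_temperature E"
proof -
  define b where "b = inverse_temperature E"
  have b: "0 < b" using inverse_temperature_pos[OF E] by (simp add: b_def)
  have "isCont inverse_temperature (energy_U M H b)"
  \<comment> \<open>Radius \<open>b / 2\<close> keeps the neighbourhood of \<open>b\<close> in the
    positive half-line.\<close>
  proof (rule isCont_inverse_function[where f = "energy_U M H" and x = b and d = "b / 2"])
    fix z assume "\<bar>z - b\<bar> \<le> b / 2"
    then have z: "0 < z" using b by linarith
    show "inverse_temperature (energy_U M H z) = z"
      by (rule inverse_temperature_energy_U[OF z])
    show "isCont (energy_U M H) z"
      by (rule DERIV_isCont[OF DERIV_energy_U[OF z]])
  qed (use b in simp)
  then show ?thesis
    by (simp add: b_def energy_U_inverse_temperature[OF E])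
qed

lemma DERIV_inverse_temperature:
  assumes E: "essinf M H < E"
  shows "(inverse_temperature has_field_derivative
           inverse (- energy_variance (inverse_temperature E))) (at E)"
proof (rule DERIV_inverse_function[of "energy_U M H"])
  show "(energy_U M H has_field_derivative - energy_variance (inverse_temperature E))
      (at (inverse_temperature E))"
    by (rule DERIV_energy_U[OF inverse_temperature_pos[OF E]])
  show "- energy_variance (inverse_temperature E) \<noteq> 0"
    using energy_variance_pos[OF inverse_temperature_pos[OF E]] by simp
  show "essinf M H < E" "E < E + 1" using E by auto
  show "energy_U M H (inverse_temperature y) = y" if "essinf M H < y" "y < E + 1" for y
    by (rule energy_U_inverse_temperature[OF that(1)])
  show "isCont inverse_temperature E"
    by (rule isCont_inverse_temperature[OF E])
qed

section \<open>Analyticity of the thermodynamic functions\<close>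

lemma Psi_real_analytic: "Psi M H real_analytic_on {0<..}"
proof -
  have "(\<lambda>\<beta>. ln (moment 0 \<beta>)) real_analytic_on {0<..}"
    by (rule real_analytic_on_compose[OF moment_real_analytic real_analytic_on_ln])
       (use moment_0_pos in auto)
  then show ?thesis by (simp add: Psi_eq[abs_def])
qed

lemma energy_U_real_analytic: "energy_U M H real_analytic_on {0<..}"
proof (rule real_analytic_on_cong)
  have "(\<lambda>\<beta>. inverse (moment 0 \<beta>)) real_analytic_on {0<..}"
    by (rule real_analytic_on_compose[OF moment_real_analytic real_analytic_on_inverse])
       (use moment_0_pos in auto)
  then show "(\<lambda>\<beta>. moment 1 \<beta> * inverse (moment 0 \<beta>)) real_analytic_on {0<..}"
    by (rule real_analytic_on_mult[OF moment_real_analytic])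
qed (simp_all add: energy_U_eq divide_inverse)

lemma inverse_temperature_real_analytic: "inverse_temperature real_analytic_on {essinf M H<..}"
proof (rule real_analytic_on_inverse_function[OF energy_U_real_analytic])
  show "(energy_U M H has_field_derivative - energy_variance x) (at x)" if "x \<in> {0<..}" for x
    using that DERIV_energy_U by simp
  show "- energy_variance x \<noteq> 0" if "x \<in> {0<..}" for x
    using that energy_variance_pos[of x] by simp
qed (auto simp: inverse_temperature_pos energy_U_inverse_temperature isCont_inverse_temperature)

text \<open>Every \<open>E\<close> above the essential infimum is the mean energy at its inverse
  temperature, so the limit found above identifies \<open>entropy_S\<close>.\<close>

lemma log_volume_tendsto_entropy:
  assumes E: "essinf M H < E"
  shows "entropy_S M H E = Psi M H (inverse_temperature E) + inverse_temperature E * E"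
    and "(\<lambda>n. log_volume M H n E) \<longlonglongrightarrow> entropy_S M H E"
proof -
  have lim: "(\<lambda>n. log_volume M H n E) \<longlonglongrightarrow> Psi M H (inverse_temperature E) + inverse_temperature E * E"
    using log_volume_tendsto[OF inverse_temperature_pos[OF E]]
    by (simp add: energy_U_inverse_temperature[OF E])
  then show eq: "entropy_S M H E = Psi M H (inverse_temperature E) + inverse_temperature E * E"
    unfolding entropy_S_def by (rule limI)
  show "(\<lambda>n. log_volume M H n E) \<longlonglongrightarrow> entropy_S M H E"
    using lim by (simp add: eq)
qed

text \<open>The Chernoff bound at the optimal parameter coincides with the limit, so every single
  term lies below it.\<close>

lemma log_volume_le_entropy:
  assumes "essinf M H < E" "1 \<le> n"
  shows "log_volume M H n E \<le> entropy_S M H E"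
  using log_volume_upper_bound[OF assms(1) inverse_temperature_pos[OF assms(1)] assms(2)]
  by (simp add: log_volume_tendsto_entropy(1)[OF assms(1)])

lemma bdd_above_log_volume:
  assumes "essinf M H < E"
  shows "bdd_above ((\<lambda>n. log_volume M H n E) ` {1..})"
  using log_volume_le_entropy[OF assms] by (intro bdd_aboveI2) auto

lemma entropy_eq_SUP:
  assumes E: "essinf M H < E"
  shows "entropy_S M H E = (SUP n\<in>{1..}. log_volume M H n E)"
proof (rule antisym)
  have "\<forall>\<^sub>F n in sequentially. log_volume M H n E \<le> (SUP n\<in>{1..}. log_volume M H n E)"
    \<comment> \<open>The index 0 is outside the range of the supremum, so the bound holds only
      eventually.\<close>
    using eventually_ge_at_top[of 1]
    by eventually_elim (intro cSUP_upper bdd_above_log_volume[OF E], simp)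
  then show "entropy_S M H E \<le> (SUP n\<in>{1..}. log_volume M H n E)"
    by (intro tendsto_upperbound[OF log_volume_tendsto_entropy(2)[OF E]]) auto
  show "(SUP n\<in>{1..}. log_volume M H n E) \<le> entropy_S M H E"
    using log_volume_le_entropy[OF E] by (intro cSUP_least) auto
qed

text \<open>The two terms containing the derivative of \<open>inverse_temperature\<close> cancel,
  because the derivative of \<open>Psi\<close> at the inverse temperature of \<open>E\<close> is
  \<open>- E\<close>.\<close>

lemma DERIV_entropy:
  assumes E: "essinf M H < E"
  shows "(entropy_S M H has_field_derivative inverse_temperature E) (at E)"
proof -
  let ?B = inverse_temperature
  have "((\<lambda>E. Psi M H (?B E)) has_field_derivative
      - energy_U M H (?B E) * inverse (- energy_variance (?B E))) (at E)"
    by (rule DERIV_chain2[OF DERIV_Psi'[OF inverse_temperature_pos[OF E]] DERIV_inverse_temperature[OF E]])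
  then have "((\<lambda>E. Psi M H (?B E) + ?B E * E) has_field_derivative ?B E) (at E)"
    using DERIV_inverse_temperature[OF E]
    by (auto intro!: derivative_eq_intros simp: energy_U_inverse_temperature[OF E])
  moreover have "\<forall>\<^sub>F e in nhds E. entropy_S M H e = Psi M H (?B e) + ?B e * e"
    using eventually_nhds_greaterThan[OF E]
    by eventually_elim (rule log_volume_tendsto_entropy(1))
  ultimately show ?thesis
    by (subst DERIV_cong_ev[OF refl _ refl])
qed

lemma deriv_entropy: "essinf M H < E \<Longrightarrow> deriv (entropy_S M H) E = inverse_temperature E"
  by (rule DERIV_imp_deriv[OF DERIV_entropy])

text \<open>The second derivative is minus the reciprocal of the energy variance.\<close>

lemma deriv_deriv_entropy_neg:
  assumes E: "essinf M H < E"
  shows "deriv (deriv (entropy_S M H)) E < 0"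
proof -
  have "\<forall>\<^sub>F e in nhds E. deriv (entropy_S M H) e = inverse_temperature e"
    using eventually_nhds_greaterThan[OF E] by eventually_elim (rule deriv_entropy)
  then have "deriv (deriv (entropy_S M H)) E = deriv inverse_temperature E"
    by (rule deriv_cong_ev) simp
  also have "\<dots> = inverse (- energy_variance (inverse_temperature E))"
    by (rule DERIV_imp_deriv[OF DERIV_inverse_temperature[OF E]])
  also have "\<dots> < 0"
    using energy_variance_pos[OF inverse_temperature_pos[OF E]] by simp
  finally show ?thesis .
qed

lemma entropy_real_analytic: "entropy_S M H real_analytic_on {essinf M H<..}"
proof (rule real_analytic_on_cong)
  have "(\<lambda>E. Psi M H (inverse_temperature E)) real_analytic_on {essinf M H<..}"
    by (rule real_analytic_on_compose[OF inverse_temperature_real_analytic Psi_real_analytic])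
       (use inverse_temperature_pos in auto)
  then show "(\<lambda>E. Psi M H (inverse_temperature E) + inverse_temperature E * E)
      real_analytic_on {essinf M H<..}"
    by (intro real_analytic_on_add real_analytic_on_mult inverse_temperature_real_analytic
        real_analytic_on_ident)
qed (simp_all add: log_volume_tendsto_entropy(1))

lemma energy_U_diffeo: "real_analytic_diffeo (energy_U M H) {0<..} {essinf M H<..}"
  unfolding real_analytic_diffeo_def
  using energy_U_bij energy_U_real_analytic inverse_temperature_real_analytic
  by (simp add: inverse_temperature_def)

lemma deriv_entropy_diffeo: "real_analytic_diffeo (deriv (entropy_S M H)) {essinf M H<..} {0<..}"
proof -
  let ?S' = "deriv (entropy_S M H)"
  have bij: "bij_betw ?S' {essinf M H<..} {0<..}"
    using inverse_temperature_bij by (rule bij_betw_cong[THEN iffD1, rotated]) (simp add: deriv_entropy)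
  moreover have "?S' real_analytic_on {essinf M H<..}"
    by (rule real_analytic_on_cong[OF inverse_temperature_real_analytic]) (simp_all add: deriv_entropy)
  \<comment> \<open>The inverse agrees on the positive half-line with the mean energy, whose
    analyticity is known.\<close>
  moreover have "inv_into {essinf M H<..} ?S' real_analytic_on {0<..}"
  proof (rule real_analytic_on_cong[OF energy_U_real_analytic])
    fix \<beta> :: real assume "\<beta> \<in> {0<..}"
    then have \<beta>: "0 < \<beta>" by simp
    have "?S' (energy_U M H \<beta>) = \<beta>"
      using \<beta> by (simp add: deriv_entropy energy_U_gt_essinf inverse_temperature_energy_U)
    then show "energy_U M H \<beta> = inv_into {essinf M H<..} ?S' \<beta>"
      using bij_betw_inv_into_left[OF bij, of "energy_U M H \<beta>"] energy_U_gt_essinf[OF \<beta>] by simp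
  qed simp
  ultimately show ?thesis
    by (simp add: real_analytic_diffeo_def)
qed

lemma deriv_entropy_strict_antimono: "strict_antimono_on {essinf M H<..} (deriv (entropy_S M H))"
proof (rule monotone_onI)
  fix x y assume xy: "x \<in> {essinf M H<..}" "y \<in> {essinf M H<..}" "x < y"
  then have pos: "0 < inverse_temperature x" "0 < inverse_temperature y"
    by (auto intro: inverse_temperature_pos)
  have "inverse_temperature y < inverse_temperature x"
  proof (rule ccontr)
    assume "\<not> ?thesis"
    then have "energy_U M H (inverse_temperature y) \<le> energy_U M H (inverse_temperature x)"
      using energy_U_strict_decreasing[OF pos(1), of "inverse_temperature y"]
      by (cases "inverse_temperature x = inverse_temperature y") auto
    then show False
      using xy by (simp add: energy_U_inverse_temperature)
  qed
  then show "deriv (entropy_S M H) y < deriv (entropy_S M H) x"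
    using xy by (simp add: deriv_entropy)
qed

text \<open>The entropy is the value of \<open>Psi M H \<beta> + \<beta> * E\<close> at its unique
  minimiser.\<close>

lemma entropy_le:
  assumes E: "essinf M H < E" and \<beta>: "0 < \<beta>"
  shows "entropy_S M H E \<le> Psi M H \<beta> + \<beta> * E"
    and "entropy_S M H E = Psi M H \<beta> + \<beta> * E \<longleftrightarrow> \<beta> = inverse_temperature E"
  using Psi_plus_linear_unique_min[OF inverse_temperature_pos[OF E] \<beta>]
    log_volume_tendsto_entropy(1)[OF E]
  by (cases "\<beta> = inverse_temperature E"; simp add: energy_U_inverse_temperature[OF E])+

text \<open>The infimum is attained at the inverse temperature of \<open>E\<close>. Boundedness is
  recorded because a real \<open>INF\<close> is meaningful only for a family bounded below.\<close>

lemma entropy_eq_INF: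
  assumes E: "essinf M H < E"
  shows "bdd_below ((\<lambda>\<beta>. Psi M H \<beta> + \<beta> * E) ` {0<..})"
    and "entropy_S M H E = (INF \<beta>\<in>{0<..}. Psi M H \<beta> + \<beta> * E)"
proof -
  show bdd: "bdd_below ((\<lambda>\<beta>. Psi M H \<beta> + \<beta> * E) ` {0<..})"
    using entropy_le(1)[OF E] by (intro bdd_belowI2) auto
  show "entropy_S M H E = (INF \<beta>\<in>{0<..}. Psi M H \<beta> + \<beta> * E)"
  proof (rule antisym)
    show "entropy_S M H E \<le> (INF \<beta>\<in>{0<..}. Psi M H \<beta> + \<beta> * E)"
      using entropy_le(1)[OF E] by (intro cINF_greatest) auto
    show "(INF \<beta>\<in>{0<..}. Psi M H \<beta> + \<beta> * E) \<le> entropy_S M H E"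
      unfolding log_volume_tendsto_entropy(1)[OF E]
      using inverse_temperature_pos[OF E] by (intro cINF_lower bdd) simp
  qed
qed

text \<open>Young's inequality bounds every term, and equality holds at
  \<open>E = energy_U M H \<beta>\<close>.\<close>

lemma Psi_eq_SUP:
  assumes \<beta>: "0 < \<beta>"
  shows "bdd_above ((\<lambda>E. entropy_S M H E - \<beta> * E) ` {essinf M H<..})"
    and "Psi M H \<beta> = (SUP E\<in>{essinf M H<..}. entropy_S M H E - \<beta> * E)"
proof -
  have le: "entropy_S M H E - \<beta> * E \<le> Psi M H \<beta>" if "essinf M H < E" for E
    using entropy_le(1)[OF that \<beta>] by simp
  show bdd: "bdd_above ((\<lambda>E. entropy_S M H E - \<beta> * E) ` {essinf M H<..})"
    using le by (intro bdd_aboveI2) auto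
  show "Psi M H \<beta> = (SUP E\<in>{essinf M H<..}. entropy_S M H E - \<beta> * E)"
  proof (rule antisym)
    have U: "essinf M H < energy_U M H \<beta>" by (rule energy_U_gt_essinf[OF \<beta>])
    have "Psi M H \<beta> = entropy_S M H (energy_U M H \<beta>) - \<beta> * energy_U M H \<beta>"
      using log_volume_tendsto_entropy(1)[OF U] by (simp add: inverse_temperature_energy_U[OF \<beta>])
    also have "\<dots> \<le> (SUP E\<in>{essinf M H<..}. entropy_S M H E - \<beta> * E)"
      using U by (intro cSUP_upper bdd) simp
    finally show "Psi M H \<beta> \<le> \<dots>" .
    show "(SUP E\<in>{essinf M H<..}. entropy_S M H E - \<beta> * E) \<le> Psi M H \<beta>"
      using le by (intro cSUP_least) auto
  qed
qed

section \<open>Boundary behaviour of the entropy\<close>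

lemma entropy_ge_log_count_N:
  assumes "essinf M H < E"
  shows "ln (enn2real (count_N M H E)) \<le> entropy_S M H E"
  using log_volume_ge_log_count_N[OF assms, of 1] log_volume_le_entropy[OF assms, of 1] by simp

lemma entropy_at_top: "filterlim (entropy_S M H) at_top at_top"
  unfolding filterlim_at_top
proof
  fix Z :: real
  obtain E0 where E0: "exp Z < enn2real (count_N M H E0)"
    using count_N_unbounded by blast
  show "\<forall>\<^sub>F E in at_top. Z \<le> entropy_S M H E"
    using eventually_gt_at_top[of "essinf M H"] eventually_ge_at_top[of E0]
  proof eventually_elim
    case (elim E)
    have "count_N M H E0 \<le> count_N M H E"
      unfolding count_N_eq using elim by (intro emeasure_mono) auto
    then have "enn2real (count_N M H E0) \<le> enn2real (count_N M H E)"
      using count_N_finite' by (intro enn2real_mono) auto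
    with E0 have "exp Z \<le> enn2real (count_N M H E)" by simp
    then have "Z \<le> ln (enn2real (count_N M H E))"
      using count_N_pos[OF elim(1)] by (simp add: ln_ge_iff)
    then show ?case
      using entropy_ge_log_count_N[OF elim(1)] by simp
  qed
qed

lemma min_level_measurable [measurable]: "min_level M H \<in> sets M"
  unfolding min_level_def by measurable

lemma emeasure_min_level_finite: "emeasure M (min_level M H) < \<infinity>"
proof -
  have "emeasure M (min_level M H) \<le> count_N M H (essinf M H)"
    unfolding count_N_eq by (intro emeasure_mono) (auto simp: min_level_def)
  then show ?thesis
    using count_N_finite'[of "essinf M H"] by (rule order.strict_trans1)
qed

text \<open>Shifting the energy by its essential infimum makes the integrand converge almost
  everywhere to the indicator of the minimal level. The parameters \<open>Suc n\<close> start at 1,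
  so the integrand at parameter 1 dominates.\<close>

lemma shifted_partition_tendsto:
  "((\<lambda>n. exp (real (Suc n) * essinf M H) * moment 0 (real (Suc n)))
      \<longlongrightarrow> measure M (min_level M H)) sequentially"
proof -
  let ?m = "essinf M H"
  have "(\<lambda>n. \<integral>x. exp (- real (Suc n) * (H x - ?m)) \<partial>M) \<longlonglongrightarrow> (\<integral>x. indicator (min_level M H) x \<partial>M)"
  proof (rule integral_dominated_convergence[where w = "\<lambda>x. exp (- 1 * H x) * exp ?m"])
    show "integrable M (\<lambda>x. exp (- 1 * H x) * exp ?m)"
      by (intro integrable_mult_left integrable_exp_H) simp
    show "AE x in M. norm (exp (- real (Suc n) * (H x - ?m))) \<le> exp (- 1 * H x) * exp ?m" for n
      using AE_essinf_le
    proof eventually_elim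
      case (elim x)
      have "1 * (H x - ?m) \<le> real (Suc n) * (H x - ?m)"
        using elim by (intro mult_right_mono) auto
      then have "- real (Suc n) * (H x - ?m) \<le> - 1 * H x + ?m"
        by (simp add: algebra_simps)
      then show ?case
        by (simp only: exp_add[symmetric] real_norm_def abs_exp_cancel exp_le_cancel_iff)
    qed
    show "AE x in M. (\<lambda>n. exp (- real (Suc n) * (H x - ?m))) \<longlonglongrightarrow> indicator (min_level M H) x"
      using AE_essinf_le AE_space
    proof eventually_elim
      case (elim x)
      show ?case
      proof (cases "H x = ?m")
        case True
        then show ?thesis using elim by (simp add: min_level_def)
      next
        case False
        then have lt: "exp (- (H x - ?m)) < 1" using elim by simp
        have "(\<lambda>n. exp (- (H x - ?m)) ^ Suc n) \<longlonglongrightarrow> 0"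
          using lt by (intro LIMSEQ_Suc LIMSEQ_power_zero) simp
        moreover have "exp (- (H x - ?m)) ^ Suc n = exp (- real (Suc n) * (H x - ?m))" for n
          by (simp only: exp_of_nat_mult[symmetric] mult_minus_left mult_minus_right)
        ultimately show ?thesis
          using False by (simp only:) (simp add: min_level_def)
      qed
    qed
  qed measurable
  moreover have "(\<integral>x. exp (- real (Suc n) * (H x - ?m)) \<partial>M)
      = exp (real (Suc n) * ?m) * moment 0 (real (Suc n))" for n
  proof -
    have "exp (- real (Suc n) * (H x - ?m)) = exp (real (Suc n) * ?m) * (H x ^ 0 * exp (- real (Suc n) * H x))" for x
      by (simp only: power_0 mult_1 exp_add[symmetric]) (simp add: algebra_simps)
    then show ?thesis
      by (simp add: moment_def del: of_nat_Suc)
  qed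
  ultimately show ?thesis by simp
qed

text \<open>From below, the minimal level lies in every sublevel set, so the log of its measure
  bounds the entropy. From above, let \<open>E\<close> tend to the essential infimum in
  \<open>Psi M H b + b * E\<close> for fixed large \<open>b\<close>; the result is the log of the
  shifted partition function.\<close>

lemma entropy_at_essinf:
  "((\<lambda>E. ereal (entropy_S M H E)) \<longlongrightarrow> ext_log (emeasure M (min_level M H))) (at_right (essinf M H))"
proof (rule order_tendstoI)
  let ?m = "essinf M H" and ?\<mu> = "emeasure M (min_level M H)"
  show "\<forall>\<^sub>F E in at_right ?m. a < ereal (entropy_S M H E)" if a: "a < ext_log ?\<mu>" for a
  proof -
    \<comment> \<open>A null minimal level would give the value minus infinity, with no
      \<open>a\<close> below it.\<close>
    have nz: "?\<mu> \<noteq> 0" using a by (auto simp: ext_log_def)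
    then have ext: "ext_log ?\<mu> = ereal (ln (enn2real ?\<mu>))"
      using emeasure_min_level_finite by (simp add: ext_log_def)
    have pos: "0 < enn2real ?\<mu>"
      using nz emeasure_min_level_finite by (simp add: enn2real_positive_iff zero_less_iff_neq_zero)
    show ?thesis
      using eventually_at_right_less[of ?m]
    proof eventually_elim
      case (elim E)
      have "?\<mu> \<le> count_N M H E"
        unfolding count_N_eq using elim by (intro emeasure_mono) (auto simp: min_level_def)
      then have "enn2real ?\<mu> \<le> enn2real (count_N M H E)"
        using count_N_finite' by (intro enn2real_mono) auto
      then have "ln (enn2real ?\<mu>) \<le> ln (enn2real (count_N M H E))"
        using pos by (intro ln_mono) auto
      also have "\<dots> \<le> entropy_S M H E"
        by (rule entropy_ge_log_count_N[OF elim])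
      finally have "ln (enn2real ?\<mu>) \<le> entropy_S M H E" .
      then show ?case
        using a unfolding ext by (simp add: order.strict_trans2)
    qed
  qed
  show "\<forall>\<^sub>F E in at_right ?m. ereal (entropy_S M H E) < a" if a: "ext_log ?\<mu> < a" for a
  proof -
    \<comment> \<open>A real \<open>c\<close> in between avoids infinite values in the estimates,
      also when the limit is minus infinity.\<close>
    obtain c where c: "ext_log ?\<mu> < ereal c" "ereal c < a"
      using a ereal_dense2 by blast
    have "measure M (min_level M H) < exp c"
    proof (cases "?\<mu> = 0")
      case False
      then have "ln (enn2real ?\<mu>) < c"
        using c(1) emeasure_min_level_finite by (simp add: ext_log_def split: if_splits)
      moreover have "0 < enn2real ?\<mu>"
        using False emeasure_min_level_finite by (simp add: enn2real_positive_iff zero_less_iff_neq_zero)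
      ultimately show ?thesis
        by (metis exp_less_cancel_iff exp_ln measure_def)
    qed (simp add: measure_def)
    then have "\<forall>\<^sub>F n in sequentially. exp (real (Suc n) * ?m) * moment 0 (real (Suc n)) < exp c"
      by (rule order_tendstoD(2)[OF shifted_partition_tendsto])
    then obtain n where n: "exp (real (Suc n) * ?m) * moment 0 (real (Suc n)) < exp c"
      using eventually_happens by force
    define b where "b = real (Suc n)"
    have b: "0 < b" by (simp add: b_def)
    have "ln (exp (b * ?m) * moment 0 b) < ln (exp c)"
      using n moment_0_pos[OF b] unfolding b_def[symmetric] by (subst ln_less_cancel_iff) auto
    then have "Psi M H b + b * ?m < c"
      using moment_0_pos[OF b] by (simp add: ln_mult Psi_eq)
    moreover have "((\<lambda>E. Psi M H b + b * E) \<longlongrightarrow> Psi M H b + b * ?m) (at_right ?m)"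
      by (intro tendsto_intros)
    ultimately have "\<forall>\<^sub>F E in at_right ?m. Psi M H b + b * E < c"
      by (intro order_tendstoD)
    then show ?thesis
      using eventually_at_right_less[of ?m]
    proof eventually_elim
      case (elim E)
      then have "ereal (entropy_S M H E) < ereal c"
        using entropy_le(1)[OF elim(2) b] by simp
      then show ?case using c(2) by (rule order.strict_trans)
    qed
  qed
qed

text \<open>The first derivative is minus the mean energy, which exceeds a non-negative essential
  infimum; the second is the energy variance.\<close>

lemma deriv_Psi:
  assumes \<beta>: "0 < \<beta>"
  shows "deriv (Psi M H) \<beta> < 0" and "0 < deriv (deriv (Psi M H)) \<beta>"
proof -
  show "deriv (Psi M H) \<beta> < 0"
    using energy_U_gt_essinf[OF \<beta>] essinf_nonneg by (simp add: energy_U_def)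
  have "((\<lambda>b. - energy_U M H b) has_field_derivative - (- energy_variance \<beta>)) (at \<beta>)"
    by (rule DERIV_minus[OF DERIV_energy_U[OF \<beta>]])
  then have "deriv (deriv (Psi M H)) \<beta> = energy_variance \<beta>"
    by (intro DERIV_imp_deriv) (simp add: energy_U_def)
  then show "0 < deriv (deriv (Psi M H)) \<beta>"
    using energy_variance_pos[OF \<beta>] by simp
qed

end

text \<open>The conclusion also records boundedness and integrability, because real
  \<open>SUP\<close> and \<open>INF\<close> and the Bochner integral are total functions that say
  nothing outside these cases.\<close>

theorem theorem5p1:
  fixes M :: "'a measure" and H :: "'a \<Rightarrow> real"
    and Hmin :: real and \<Psi> U S :: "real \<Rightarrow> real"
  assumes sigma_finite: "sigma_finite_measure M"
    and nonzero: "emeasure M (space M) \<noteq> 0"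
    and H_measurable: "H \<in> borel_measurable M"
    and H_nonneg: "\<And>x. x \<in> space M \<Longrightarrow> 0 \<le> H x"
    and T1: "emeasure M (space M) = \<infinity>"
    and T2_finite: "\<And>E. 0 \<le> E \<Longrightarrow> count_N M H E < \<infinity>"
    and T2_growth: "(\<lambda>E. ln (enn2real (count_N M H E))) \<in> o[at_top](\<lambda>E. E)"
  defines "Hmin \<equiv> essinf M H"
    and "\<Psi> \<equiv> Psi M H"
    and "U \<equiv> energy_U M H"
    and "S \<equiv> entropy_S M H"
  shows "((\<forall>E>Hmin.
        (\<forall>n\<ge>1. 0 < volume_A M H n E \<and> volume_A M H n E < \<infinity>) \<and>
        (\<lambda>n. log_volume M H n E) \<longlonglongrightarrow> S E \<and>
        bdd_above ((\<lambda>n. log_volume M H n E) ` {1..}) \<and>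
        S E = (SUP n\<in>{1..}. log_volume M H n E)) \<and>
     S real_analytic_on {Hmin<..} \<and>
     (\<forall>E>Hmin. deriv S E > 0 \<and> deriv (deriv S) E < 0) \<and>
     ((\<lambda>E. ereal (S E)) \<longlongrightarrow> ext_log (emeasure M (min_level M H))) (at_right Hmin) \<and>
     filterlim S at_top at_top \<and>
     real_analytic_diffeo (deriv S) {Hmin<..} {0<..} \<and>
     strict_antimono_on {Hmin<..} (deriv S)) \<and>
    ((\<forall>\<beta>>0. integrable M (\<lambda>x. exp (- \<beta> * H x)) \<and> 0 < partition_Z M H \<beta>) \<and>
     \<Psi> real_analytic_on {0<..} \<and>
     (\<forall>\<beta>>0. deriv \<Psi> \<beta> < 0 \<and> deriv (deriv \<Psi>) \<beta> > 0) \<and>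
     real_analytic_diffeo U {0<..} {Hmin<..} \<and>
     strict_antimono_on {0<..} U \<and>
     (\<forall>\<beta>>0. integrable M (\<lambda>x. H x * exp (- \<beta> * H x)) \<and>
        U \<beta> = (\<integral>x. H x * exp (- \<beta> * H x) \<partial>M) / (\<integral>x. exp (- \<beta> * H x) \<partial>M))) \<and>
    ((\<forall>E>Hmin. bdd_below ((\<lambda>\<beta>. \<Psi> \<beta> + \<beta> * E) ` {0<..}) \<and>
        S E = (INF \<beta>\<in>{0<..}. \<Psi> \<beta> + \<beta> * E)) \<and>
     (\<forall>\<beta>>0. bdd_above ((\<lambda>E. S E - \<beta> * E) ` {Hmin<..}) \<and>
        \<Psi> \<beta> = (SUP E\<in>{Hmin<..}. S E - \<beta> * E)) \<and>
     (\<forall>E>Hmin. U (deriv S E) = E) \<and>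
     (\<forall>\<beta>>0. deriv S (U \<beta>) = \<beta>) \<and>
     (\<forall>E>Hmin. \<forall>\<beta>>0. S E \<le> \<Psi> \<beta> + \<beta> * E \<and>
        (S E = \<Psi> \<beta> + \<beta> * E \<longleftrightarrow> \<beta> = deriv S E) \<and>
        (\<beta> = deriv S E \<longleftrightarrow> E = U \<beta>)))"
proof -
  interpret gibbs_system M H
    by (intro gibbs_system.intro gibbs_system_axioms.intro sigma_finite H_measurable H_nonneg T1
        T2_finite T2_growth)
  have U_deriv: "\<forall>E>essinf M H. energy_U M H (deriv (entropy_S M H) E) = E"
    by (simp add: deriv_entropy energy_U_inverse_temperature)
  have deriv_U: "\<forall>\<beta>>0. deriv (entropy_S M H) (energy_U M H \<beta>) = \<beta>"
    by (simp add: deriv_entropy energy_U_gt_essinf inverse_temperature_energy_U)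
  have antimono: "strict_antimono_on {0<..} (energy_U M H)"
    by (rule monotone_onI) (simp add: energy_U_strict_decreasing)
  have U_eq: "\<forall>\<beta>>0. integrable M (\<lambda>x. H x * exp (- \<beta> * H x)) \<and>
      energy_U M H \<beta> = (\<integral>x. H x * exp (- \<beta> * H x) \<partial>M) / (\<integral>x. exp (- \<beta> * H x) \<partial>M)"
  proof (intro allI impI conjI)
    fix \<beta> :: real assume \<beta>: "0 < \<beta>"
    show "integrable M (\<lambda>x. H x * exp (- \<beta> * H x))"
      using integrable_moment[OF \<beta>, of 1] by simp
    show "energy_U M H \<beta> = (\<integral>x. H x * exp (- \<beta> * H x) \<partial>M) / (\<integral>x. exp (- \<beta> * H x) \<partial>M)"
      using energy_U_eq[OF \<beta>] by (simp add: moment_def)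
  qed
  have volume: "\<forall>E>essinf M H.
      (\<forall>n\<ge>1. 0 < volume_A M H n E \<and> volume_A M H n E < \<infinity>) \<and>
      (\<lambda>n. log_volume M H n E) \<longlonglongrightarrow> entropy_S M H E \<and>
      bdd_above ((\<lambda>n. log_volume M H n E) ` {1..}) \<and>
      entropy_S M H E = (SUP n\<in>{1..}. log_volume M H n E)"
    by (intro allI impI conjI volume_A_pos volume_A_finite log_volume_tendsto_entropy(2)
        bdd_above_log_volume entropy_eq_SUP)
  have S': "\<forall>E>essinf M H. deriv (entropy_S M H) E > 0 \<and> deriv (deriv (entropy_S M H)) E < 0"
    using deriv_deriv_entropy_neg inverse_temperature_pos by (simp add: deriv_entropy)
  have Z: "\<forall>\<beta>>0. integrable M (\<lambda>x. exp (- \<beta> * H x)) \<and> 0 < partition_Z M H \<beta>"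
    by (intro allI impI conjI integrable_exp_H) (simp_all add: partition_Z_eq moment_0_pos)
  have \<Psi>': "\<forall>\<beta>>0. deriv (Psi M H) \<beta> < 0 \<and> deriv (deriv (Psi M H)) \<beta> > 0"
    by (intro allI impI conjI deriv_Psi)
  have INF: "\<forall>E>essinf M H. bdd_below ((\<lambda>\<beta>. Psi M H \<beta> + \<beta> * E) ` {0<..}) \<and>
      entropy_S M H E = (INF \<beta>\<in>{0<..}. Psi M H \<beta> + \<beta> * E)"
    by (intro allI impI conjI entropy_eq_INF)
  have SUP: "\<forall>\<beta>>0. bdd_above ((\<lambda>E. entropy_S M H E - \<beta> * E) ` {essinf M H<..}) \<and>
      Psi M H \<beta> = (SUP E\<in>{essinf M H<..}. entropy_S M H E - \<beta> * E)"
    by (intro allI impI conjI Psi_eq_SUP)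
  have Young: "\<forall>E>essinf M H. \<forall>\<beta>>0. entropy_S M H E \<le> Psi M H \<beta> + \<beta> * E \<and>
      (entropy_S M H E = Psi M H \<beta> + \<beta> * E \<longleftrightarrow> \<beta> = deriv (entropy_S M H) E) \<and>
      (\<beta> = deriv (entropy_S M H) E \<longleftrightarrow> E = energy_U M H \<beta>)"
  proof (intro allI impI conjI)
    fix E \<beta> :: real assume E: "essinf M H < E" and \<beta>: "0 < \<beta>"
    show "entropy_S M H E \<le> Psi M H \<beta> + \<beta> * E"
      by (rule entropy_le(1)[OF E \<beta>])
    show "entropy_S M H E = Psi M H \<beta> + \<beta> * E \<longleftrightarrow> \<beta> = deriv (entropy_S M H) E"
      unfolding deriv_entropy[OF E] by (rule entropy_le(2)[OF E \<beta>])
    show "\<beta> = deriv (entropy_S M H) E \<longleftrightarrow> E = energy_U M H \<beta>"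
      using U_deriv E deriv_U \<beta> by auto
  qed
  show ?thesis
    unfolding Hmin_def \<Psi>_def U_def S_def
    by (intro conjI volume entropy_real_analytic S' entropy_at_essinf entropy_at_top
        deriv_entropy_diffeo deriv_entropy_strict_antimono Z Psi_real_analytic \<Psi>' energy_U_diffeo
        antimono U_eq INF SUP U_deriv deriv_U Young)
qed

end
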